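(* Let $(n,2d)=(3,6)$ or $(n,2d)=(4,4)$, and $s=d^{n-1}$. Suppose that $\ell\in H_{n,2d}^*$ spans an extreme ray of $\Sigma_{n,2d}^*$ that does not correspond to point evaluation. Let $W_\ell\subset H_{n,d}$ be the kernel of $Q_\ell$, and suppose that $f_1,\ldots,f_{n-1}\in W_\ell$ intersect transversely in $s$ projective points $\gamma_1,\ldots,\gamma_s$, consisting of a single complex conjugate pair of non-real points with the rest of the $\gamma_i$ real. Let $v_1,\ldots,v_{s-2}\in\mathbb{R}^n$ be affine representatives of the real $\gamma_i$ and let $z,\bar z\in\mathbb{C}^n$ be affine representatives of the non-real ones, chosen such that $$u_1f(v_1)+\cdots+u_{s-2}f(v_{s-2})+f(z)+f(\bar z)=0\quad\text{for all } f\in H_{n,d},$$ with $u_i\in\mathbb{R}$, is the unique Cayley-Bacharach relation on the points $v_i,z,\bar z$. Then the form $Q_\ell$ can be uniquely written as $$Q_\ell(f)=a_1f(v_1)^2+\cdots+a_{s-2}f(v_{s-2})^2+2m\left((\operatorname{Re} f(z))^2-(\operatorname{Im} f(z))^2\right)-4t\,\operatorname{Re} f(z)\,\operatorname{Im} f(z)\quad\text{for } f\in H_{n,d},$$ with all $a_i>0$ and $m,t\in\mathbb{R}$ (not both zero) satisfying $$\frac{2m}{m^2+t^2}+\sum_{i=1}^{s-2}\frac{u_i^2}{a_i}=0.$$ Furthermore, any such form (for the same points $v_i,z$, and any real $a_i>0$, $m$, $t$ with $m,t$ not both zero satisfying $\frac{2m}{m^2+t^2}+\sum_{i=1}^{s-2}\frac{u_i^2}{a_i}=0$)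 is extreme in $\Sigma_{n,2d}^*$.
   Context: $H_{n,d}$ is the real vector space of real forms (homogeneous polynomials) of degree $d$ in $n$ variables. $\Sigma_{n,2d}=\{p\in H_{n,2d} : p=\sum_i q_i^2 \text{ for some } q_i\in H_{n,d}\}$, and $\Sigma_{n,2d}^*=\{\ell\in H_{n,2d}^* : \ell(p)\ge 0 \text{ for all } p\in\Sigma_{n,2d}\}$. For $\ell\in H_{n,2d}^*$, $Q_\ell$ is the quadratic form on $H_{n,d}$ given by $Q_\ell(f)=\ell(f^2)$; $H_{n,2d}^*$ is identified via $\ell\mapsto Q_\ell$ with a subspace of the quadratic forms on $H_{n,d}$, so one may speak of $Q_\ell$ as an element of $\Sigma_{n,2d}^*$. The functional $\ell$ corresponds to point evaluation if it is (up to a scalar multiple) $f\mapsto f(v)$ for some $v\in\mathbb{R}^n$. "Extreme in $\Sigma_{n,2d}^*$" means spanning an extreme ray. Forms $f_1,\ldots,f_{n-1}\in H_{n,d}$ intersect transversely if their common zero set in $\mathbb{CP}^{n-1}$ is finite and at each common zero their gradients are linearly independent; it then consists of exactly $s=d^{n-1}$ distinct points. Cayley-Bacharach theorem: in the cases $(3,6)$ and $(4,4)$, for affine representatives $z_1,\ldots,z_s$ of these points there is a unique (up to scaling) linear relation $u_1p(z_1)+\cdots+u_sp(z_s)=0$ valid for all $p\in H_{n,d}$, and all $u_i\in\mathbb{C}$ are nonzero. *)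

theory Defs
  imports "HOL-Analysis.Analysis" "HOL-Library.Poly_Mapping"
begin

text \<open>
  Real polynomials in variables indexed by a finite type \<open>'n\<close>: finitely supported maps from
  exponent vectors to coefficients, with the convolution product of \<^theory>\<open>HOL-Library.Poly_Mapping\<close>.
  The number of variables is \<open>CARD('n)\<close>.
\<close>

type_synonym 'n rpoly = "('n \<Rightarrow>\<^sub>0 nat) \<Rightarrow>\<^sub>0 real"

definition forms :: "nat \<Rightarrow> 'n::finite rpoly set" where
  "forms k = {p. \<forall>\<alpha>\<in>Poly_Mapping.keys p. (\<Sum>i\<in>UNIV. Poly_Mapping.lookup \<alpha> i) = k}"

definition scale :: "real \<Rightarrow> 'n rpoly \<Rightarrow> 'n rpoly" where
  "scale c p = Poly_Mapping.map (\<lambda>x. c * x) p"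

text \<open>Used both at real and at complex points; at type \<^typ>\<open>real\<close> the map \<open>of_real\<close> is the identity.\<close>

definition ev :: "'n::finite rpoly \<Rightarrow> 'a::real_normed_field ^ 'n \<Rightarrow> 'a" where
  "ev p x = (\<Sum>\<alpha>\<in>Poly_Mapping.keys p.
     of_real (Poly_Mapping.lookup p \<alpha>) * (\<Prod>i\<in>UNIV. (x $ i) ^ Poly_Mapping.lookup \<alpha> i))"

definition sos_cone :: "nat \<Rightarrow> 'n::finite rpoly set" where
  "sos_cone d = {p \<in> forms (2 * d). \<exists>qs. set qs \<subseteq> forms d \<and> p = (\<Sum>q\<leftarrow>qs. q ^ 2)}"

text \<open>
  A linear functional on the forms of degree \<open>k\<close> is a function on all polynomials that is linear on
  these forms. It is required to vanish elsewhere, so that equality of functions is equality of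
  functionals.
\<close>

definition form_dual :: "nat \<Rightarrow> ('n::finite rpoly \<Rightarrow> real) set" where
  "form_dual k = {l.
     (\<forall>p\<in>forms k. \<forall>q\<in>forms k. l (p + q) = l p + l q) \<and>
     (\<forall>c. \<forall>p\<in>forms k. l (scale c p) = c * l p) \<and>
     (\<forall>p. p \<notin> forms k \<longrightarrow> l p = 0)}"

definition sos_dual :: "nat \<Rightarrow> ('n::finite rpoly \<Rightarrow> real) set" where
  "sos_dual d = {l \<in> form_dual (2 * d). \<forall>p\<in>sos_cone d. 0 \<le> l p}"

definition spans_extreme_ray :: "nat \<Rightarrow> ('n::finite rpoly \<Rightarrow> real) \<Rightarrow> bool" where
  "spans_extreme_ray d l \<longleftrightarrow> l \<in> sos_dual d \<and> l \<noteq> (\<lambda>p. 0) \<and>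
     (\<forall>l1\<in>sos_dual d. \<forall>l2\<in>sos_dual d. l = (\<lambda>p. l1 p + l2 p) \<longrightarrow>
        (\<exists>c\<ge>0. l1 = (\<lambda>p. c * l p)))"

definition is_point_evaluation :: "nat \<Rightarrow> ('n::finite rpoly \<Rightarrow> real) \<Rightarrow> bool" where
  "is_point_evaluation d l \<longleftrightarrow> (\<exists>(v :: real ^ 'n) c. \<forall>p\<in>forms (2 * d). l p = c * ev p v)"

definition Qform :: "('n::finite rpoly \<Rightarrow> real) \<Rightarrow> 'n rpoly \<Rightarrow> real" where
  "Qform l f = l (f ^ 2)"

text \<open>The kernel (radical) of the quadratic form \<^term>\<open>Qform l\<close> on the forms of degree \<open>d\<close>; its
  associated symmetric bilinear form sends \<open>f\<close>, \<open>g\<close> to \<open>l (f * g)\<close>.\<close>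

definition Qker :: "nat \<Rightarrow> ('n::finite rpoly \<Rightarrow> real) \<Rightarrow> 'n rpoly set" where
  "Qker d l = {f \<in> forms d. \<forall>g\<in>forms d. l (f * g) = 0}"

text \<open>Points of complex projective space are the lines through the origin.\<close>

definition proj_pt :: "complex ^ 'n::finite \<Rightarrow> (complex ^ 'n) set" where
  "proj_pt z = vec.span {z}"

definition common_zeros :: "nat \<Rightarrow> (nat \<Rightarrow> 'n::finite rpoly) \<Rightarrow> (complex ^ 'n) set set" where
  "common_zeros r F = {proj_pt z | z. z \<noteq> 0 \<and> (\<forall>j\<in>{1..r}. ev (F j) z = 0)}"

definition grad :: "'n::finite rpoly \<Rightarrow> complex ^ 'n \<Rightarrow> complex ^ 'n" where
  "grad p z = (\<chi> i. deriv (\<lambda>t. ev p (z + axis i t)) 0)"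

text \<open>Injectivity makes this independence of the family of gradients, not merely of the set of
  their values.\<close>

definition intersect_transversely :: "nat \<Rightarrow> (nat \<Rightarrow> 'n::finite rpoly) \<Rightarrow> bool" where
  "intersect_transversely r F \<longleftrightarrow> finite (common_zeros r F) \<and>
     (\<forall>z. z \<noteq> 0 \<and> (\<forall>j\<in>{1..r}. ev (F j) z = 0) \<longrightarrow>
        inj_on (\<lambda>j. grad (F j) z) {1..r} \<and> vec.independent ((\<lambda>j. grad (F j) z) ` {1..r}))"

definition cvec :: "real ^ 'n::finite \<Rightarrow> complex ^ 'n" where
  "cvec v = (\<chi> i. complex_of_real (v $ i))"

definition cnj_vec :: "complex ^ 'n::finite \<Rightarrow> complex ^ 'n" where
  "cnj_vec z = (\<chi> i. cnj (z $ i))"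

text \<open>
  A linear relation with coefficients \<open>w i\<close>, \<open>b\<close>, \<open>c\<close> among the evaluations of the forms of degree
  \<open>d\<close> at the points \<open>v 1, \<dots>, v r\<close>, \<open>z\<close> and the conjugate of \<open>z\<close>.
\<close>

definition eval_relation ::
  "nat \<Rightarrow> nat \<Rightarrow> (nat \<Rightarrow> real ^ 'n::finite) \<Rightarrow> complex ^ 'n \<Rightarrow>
   (nat \<Rightarrow> complex) \<Rightarrow> complex \<Rightarrow> complex \<Rightarrow> bool" where
  "eval_relation d r v z w b c \<longleftrightarrow>
     (\<forall>f\<in>forms d.
        (\<Sum>i=1..r. w i * complex_of_real (ev f (v i))) + b * ev f z + c * ev f (cnj_vec z) = 0)"

text \<open>
  The last two terms are the sum of \<open>(m + i t) f(z)\<^sup>2\<close> and its complex conjugate.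
\<close>

definition pair_form ::
  "nat \<Rightarrow> (nat \<Rightarrow> real ^ 'n::finite) \<Rightarrow> complex ^ 'n \<Rightarrow>
   (nat \<Rightarrow> real) \<Rightarrow> real \<Rightarrow> real \<Rightarrow> 'n rpoly \<Rightarrow> real" where
  "pair_form r v z a m t f =
     (\<Sum>i=1..r. a i * (ev f (v i))\<^sup>2)
     + 2 * m * ((Re (ev f z))\<^sup>2 - (Im (ev f z))\<^sup>2) - 4 * t * Re (ev f z) * Im (ev f z)"

definition admissible ::
  "nat \<Rightarrow> (nat \<Rightarrow> real) \<Rightarrow> (nat \<Rightarrow> real) \<Rightarrow> real \<Rightarrow> real \<Rightarrow> bool" where
  "admissible r u a m t \<longleftrightarrow>
     (\<forall>i\<in>{1..r}. 0 < a i) \<and> \<not> (m = 0 \<and> t = 0) \<and>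
     2 * m / (m\<^sup>2 + t\<^sup>2) + (\<Sum>i=1..r. (u i)\<^sup>2 / a i) = 0"

end

theory Submission
  imports Defs
begin

text \<open>
  Let \<open>r = n - 1\<close>. At every common zero of \<open>F\<^sub>1, \<dots>, F\<^sub>r\<close> the gradients are independent, so
  differentiating \<open>\<Sum>\<^sub>j F\<^sub>j g\<^sub>j = 0\<close> there shows that the \<open>g\<^sub>j\<close> vanish at all the points. This bounds
  the syzygies from above, and since the evaluations at the points have rank \<open>s - 1\<close> in degree \<open>d\<close>
  (uniqueness of the Cayley-Bacharach relation) and rank \<open>s\<close> in higher degrees, a dimension count
  gives Noether's theorem: forms of degree \<open>2d\<close> (and of degree \<open>d + 1\<close>) that vanish at the points
  lie in the ideal of the \<open>F\<^sub>j\<close>. The version in degree \<open>d + 1\<close> implies that no \<open>u\<^sub>i\<close> is zero.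

  By the version in degree \<open>2d\<close>, \<open>\<ell>\<close> is a combination of evaluations at the points, so \<open>Q\<^sub>\<ell>\<close> is the
  restriction of a diagonal form with entries \<open>a\<^sub>i\<close>, \<open>\<mu> = m + i t\<close> and its conjugate to the hyperplane
  \<open>\<Sum> u\<^sub>i x\<^sub>i + 2 Re w = 0\<close>. The vector with entries \<open>u\<^sub>i / a\<^sub>i\<close> and \<open>1 / \<mu>\<close> is, with respect to
  the diagonal form, orthogonal to that hyperplane, and the form takes the value
  \<open>\<Phi> = 2m / (m\<^sup>2 + t\<^sup>2) + \<Sum> u\<^sub>i\<^sup>2 / a\<^sub>i\<close> at it. Semidefiniteness on the hyperplane amounts to \<open>\<Phi> \<le> 0\<close>;
  if \<open>\<Phi> < 0\<close> a multiple of a point evaluation can be split off, and if \<open>\<Phi> = 0\<close> that vector spans the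
  radical, which forces every summand of \<open>Q\<^sub>\<ell>\<close> to be proportional to \<open>Q\<^sub>\<ell>\<close>.
\<close>

subsection \<open>Families of linear functionals\<close>

text \<open>Linearity is asked on \<open>V\<close> alone, since elements of
  \<open>form_dual k\<close> are zero off \<open>forms k\<close>. The scalar field is general: real
  forms and complex vectors both occur.\<close>

definition (in vector_space) functional_on :: "'b set \<Rightarrow> ('b \<Rightarrow> 'a) \<Rightarrow> bool" where
  "functional_on V f \<longleftrightarrow>
     (\<forall>x\<in>V. \<forall>y\<in>V. f (x + y) = f x + f y) \<and> (\<forall>c. \<forall>x\<in>V. f (scale c x) = c * f x)"

lemma (in vector_space) functional_on_diff_scale:
  assumes "functional_on V f" "functional_on V g"
  shows "functional_on V (\<lambda>x. f x - c * g x)"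
  using assms by (simp add: functional_on_def algebra_simps)

text \<open>Induction on the family. A functional that vanishes on the common kernel of the others
  gets coefficient 0; otherwise a vector \<open>e\<close> of that kernel with value 1 splits it
  off.\<close>

lemma (in vector_space) functional_span:
  assumes "finite I" and V: "subspace V"
    and "\<And>i. i \<in> I \<Longrightarrow> functional_on V (f i)" and "functional_on V g"
    and "\<And>x. x \<in> V \<Longrightarrow> \<forall>i\<in>I. f i x = 0 \<Longrightarrow> g x = 0"
  shows "\<exists>c. \<forall>x\<in>V. g x = (\<Sum>i\<in>I. c i * f i x)"
  using assms(1,3-)
proof (induction I arbitrary: g rule: finite_induct)
  case empty
  then show ?case by auto
next
  case (insert j I)
  show ?case
  proof (cases "\<forall>x\<in>V. (\<forall>i\<in>I. f i x = 0) \<longrightarrow> f j x = 0")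
    case True
    have "\<exists>c. \<forall>x\<in>V. g x = (\<Sum>i\<in>I. c i * f i x)"
      using True insert.prems by (intro insert.IH) auto
    then obtain c where c: "\<forall>x\<in>V. g x = (\<Sum>i\<in>I. c i * f i x)" by blast
    have "(\<Sum>i\<in>I. (c(j := 0)) i * f i x) = (\<Sum>i\<in>I. c i * f i x)" for x
      using insert.hyps by (intro sum.cong) auto
    then have "\<forall>x\<in>V. g x = (\<Sum>i\<in>insert j I. (c(j := 0)) i * f i x)"
      using c insert.hyps by simp
    then show ?thesis by blast
  next
    case False
    then obtain x0 where x0: "x0 \<in> V" "\<forall>i\<in>I. f i x0 = 0" "f j x0 \<noteq> 0" by blast
    define e where "e = scale (inverse (f j x0)) x0"
    have lin: "functional_on V (f i)" if "i \<in> insert j I" for i using insert.prems that by blast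
    have e: "e \<in> V" "\<forall>i\<in>I. f i e = 0" "f j e = 1"
      using x0 lin subspace_scale[OF V] by (auto simp: e_def functional_on_def)
    have "\<exists>c. \<forall>x\<in>V. g x - g e * f j x = (\<Sum>i\<in>I. c i * f i x)"
    proof (rule insert.IH)
      show "functional_on V (\<lambda>x. g x - g e * f j x)"
        using functional_on_diff_scale insert.prems by auto
      fix x assume x: "x \<in> V" "\<forall>i\<in>I. f i x = 0"
      define y where "y = x + scale (- f j x) e"
      have sc: "scale (- f j x) e \<in> V" using e subspace_scale[OF V] by blast
      have yV: "y \<in> V" unfolding y_def by (rule subspace_add[OF V x(1) sc])
      have "f i y = f i x + (- f j x) * f i e" if "i \<in> insert j I" for i
        using lin[OF that] x e sc unfolding y_def functional_on_def by metis
      then have "\<forall>i\<in>insert j I. f i y = 0" using x e by auto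
      then have "g y = 0" using insert.prems yV by blast
      moreover have "g y = g x + (- f j x) * g e"
        using insert.prems(2) x e sc unfolding y_def functional_on_def by metis
      ultimately show "g x - g e * f j x = 0" by (simp add: algebra_simps)
    qed (use insert.prems in auto)
    then obtain c where c: "\<forall>x\<in>V. g x - g e * f j x = (\<Sum>i\<in>I. c i * f i x)" by blast
    have "(\<Sum>i\<in>I. (c(j := g e)) i * f i x) = (\<Sum>i\<in>I. c i * f i x)" for x
      using insert.hyps by (intro sum.cong) auto
    then have "\<forall>x\<in>V. g x = (\<Sum>i\<in>insert j I. (c(j := g e)) i * f i x)"
      using c insert.hyps by (simp add: algebra_simps)
    then show ?thesis by blast
  qed
qed

text \<open>By \<open>functional_span\<close>, independence keeps each \<open>f j\<close> from
  vanishing on the common kernel of the others; rescaling a vector of that kernel gives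
  \<open>e j\<close>.\<close>

lemma (in vector_space) dual_family:
  assumes I: "finite I" and V: "subspace V"
    and lin: "\<And>i. i \<in> I \<Longrightarrow> functional_on V (f i)"
    and indep: "\<And>c. \<forall>x\<in>V. (\<Sum>i\<in>I. c i * f i x) = 0 \<Longrightarrow> \<forall>i\<in>I. c i = 0"
  shows "\<exists>e. \<forall>j\<in>I. e j \<in> V \<and> (\<forall>i\<in>I. f i (e j) = (if i = j then 1 else 0))"
proof -
  have "\<exists>x\<in>V. \<forall>i\<in>I. f i x = (if i = j then 1 else 0)" if j: "j \<in> I" for j
  proof -
    have "\<exists>x\<in>V. (\<forall>i\<in>I - {j}. f i x = 0) \<and> f j x \<noteq> 0"
    proof (rule ccontr)
      assume "\<not> ?thesis"
      then have "\<exists>c. \<forall>x\<in>V. f j x = (\<Sum>i\<in>I - {j}. c i * f i x)"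
        using I V lin j by (intro functional_span) auto
      then obtain c where c: "\<forall>x\<in>V. f j x = (\<Sum>i\<in>I - {j}. c i * f i x)" by blast
      have "(\<Sum>i\<in>I. (c(j := - 1)) i * f i x) = 0" if "x \<in> V" for x
      proof -
        have "(\<Sum>i\<in>I. (c(j := - 1)) i * f i x) = - f j x + (\<Sum>i\<in>I - {j}. (c(j := - 1)) i * f i x)"
          using I j by (subst sum.remove[of I j]) auto
        also have "(\<Sum>i\<in>I - {j}. (c(j := - 1)) i * f i x) = (\<Sum>i\<in>I - {j}. c i * f i x)"
          by (intro sum.cong) auto
        finally show ?thesis using c that by simp
      qed
      then have "(c(j := - 1)) j = 0" using indep j by blast
      then show False by simp
    qed
    then obtain x where x: "x \<in> V" "\<forall>i\<in>I - {j}. f i x = 0" "f j x \<noteq> 0" by blast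
    have "f i (scale (inverse (f j x)) x) = (if i = j then 1 else 0)" if "i \<in> I" for i
      using lin[OF that] x that by (auto simp: functional_on_def)
    then show ?thesis using x subspace_scale[OF V] by blast
  qed
  then show ?thesis by metis
qed

text \<open>The exchange lemma: an independent family no smaller than a spanning set spans.
  Independence is stated with coefficients on the index set, so it also excludes repeated
  vectors.\<close>

lemma (in vector_space) spans_of_large_family:
  assumes A: "finite A" and S: "finite S" and card: "card S \<le> card A"
    and bS: "b ` A \<subseteq> span S"
    and indep: "\<And>c. (\<Sum>a\<in>A. scale (c a) (b a)) = 0 \<Longrightarrow> \<forall>a\<in>A. c a = 0"
    and y: "y \<in> span S"
  shows "\<exists>c. y = (\<Sum>a\<in>A. scale (c a) (b a))"
proof -
  have inj: "inj_on b A"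
  proof (rule inj_onI, rule ccontr)
    fix x y assume xy: "x \<in> A" "y \<in> A" "b x = b y" "x \<noteq> y"
    define c where "c = (\<lambda>a. if a = x then 1 else if a = y then - 1 else (0::'a))"
    have "(\<Sum>a\<in>A. scale (c a) (b a)) = (\<Sum>a\<in>{x, y}. scale (c a) (b a))"
      using A xy by (intro sum.mono_neutral_right) (auto simp: c_def)
    also have "\<dots> = 0" using xy by (simp add: c_def)
    finally have "c x = 0" using indep xy by blast
    then show False by (simp add: c_def)
  qed
  have ind: "independent (b ` A)"
  proof (rule independent_if_scalars_zero)
    fix g w assume "(\<Sum>w\<in>b ` A. scale (g w) w) = 0" and w: "w \<in> b ` A"
    then have "(\<Sum>a\<in>A. scale (g (b a)) (b a)) = 0" by (simp add: sum.reindex[OF inj])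
    then show "g w = 0" using indep[of "g \<circ> b"] w by auto
  qed (use A in simp)
  have "y \<in> span (b ` A)"
  proof (rule ccontr)
    assume "y \<notin> span (b ` A)"
    then have n: "y \<notin> b ` A" and "independent (insert y (b ` A))"
      using ind independent_insertI span_base by blast+
    moreover have "insert y (b ` A) \<subseteq> span S" using y bS by blast
    ultimately have "card (insert y (b ` A)) \<le> card S" using S independent_span_bound by blast
    then show False using n A card inj by (simp add: card_image)
  qed
  then obtain g where "y = (\<Sum>w\<in>b ` A. scale (g w) w)"
    using A by (subst (asm) span_finite) auto
  then have "y = (\<Sum>a\<in>A. scale (g (b a)) (b a))" by (simp add: sum.reindex[OF inj])
  then show ?thesis by (rule exI[of _ "\<lambda>a. g (b a)"])
qed

subsection \<open>Polynomials and their evaluation\<close>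

lemma scale_conv_mult: "scale c p = Poly_Mapping.single 0 c * p"
  by (simp add: scale_def mult_map_scale_conv_mult)

lemma lookup_scale [simp]: "Poly_Mapping.lookup (scale c p) \<alpha> = c * Poly_Mapping.lookup p \<alpha>"
  by (simp add: scale_def Poly_Mapping.map.rep_eq when_def)

interpretation rp: vector_space "scale :: real \<Rightarrow> 'n rpoly \<Rightarrow> 'n rpoly"
  by unfold_locales (auto intro!: poly_mapping_eqI simp: lookup_add algebra_simps)

lemma scale_mult_left: "scale c p * q = scale c (p * q)"
  and scale_mult_right: "p * scale c q = scale c (p * (q :: 'n rpoly))"
  by (simp_all add: scale_conv_mult mult.assoc mult.left_commute)

lemma rpoly_sum_monomials:
  "p = (\<Sum>\<alpha>\<in>Poly_Mapping.keys p. Poly_Mapping.single \<alpha> (Poly_Mapping.lookup p \<alpha>))"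
  by (rule poly_mapping_eqI)
    (auto simp: lookup_sum lookup_single when_def in_keys_iff sum.delta' cong: if_cong)

lemma rpoly_add_induct [case_names zero monom add]:
  fixes p :: "'n rpoly"
  assumes "P 0" "\<And>\<alpha> c. P (Poly_Mapping.single \<alpha> c)" "\<And>p q. P p \<Longrightarrow> P q \<Longrightarrow> P (p + q)"
  shows "P p"
proof -
  have "P (\<Sum>\<alpha>\<in>A. Poly_Mapping.single \<alpha> (Poly_Mapping.lookup p \<alpha>))" if "finite A" for A
    using that by (induction A rule: finite_induct) (use assms in auto)
  then show ?thesis using rpoly_sum_monomials[of p] by (metis finite_keys)
qed

definition var :: "'n::finite \<Rightarrow> 'n rpoly" where
  "var i = Poly_Mapping.single (Poly_Mapping.single i 1) 1"

text \<open>Constants and variables generate the ring: a monomial of positive degree splits off a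
  variable, by induction on the total degree.\<close>

lemma rpoly_ring_induct [case_names const var add mult]:
  fixes p :: "'n::finite rpoly"
  assumes const: "\<And>c. P (Poly_Mapping.single 0 c)" and var: "\<And>i. P (var i)"
    and add: "\<And>p q. P p \<Longrightarrow> P q \<Longrightarrow> P (p + q)" and mult: "\<And>p q. P p \<Longrightarrow> P q \<Longrightarrow> P (p * q)"
  shows "P p"
proof (induction p rule: rpoly_add_induct)
  case (monom \<alpha> c)
  show ?case
  proof (induction n \<equiv> "\<Sum>i\<in>UNIV. Poly_Mapping.lookup \<alpha> i" arbitrary: \<alpha>)
    case 0
    then have "\<alpha> = 0" by (intro poly_mapping_eqI) auto
    then show ?case using const by simp
  next
    case (Suc n)
    then obtain i where i: "Poly_Mapping.lookup \<alpha> i \<noteq> 0"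
      by (metis sum.neutral nat.distinct(1))
    define \<beta> where "\<beta> = \<alpha> - Poly_Mapping.single i 1"
    have \<alpha>: "\<alpha> = \<beta> + Poly_Mapping.single i 1"
      unfolding \<beta>_def using i by (intro poly_mapping_eqI) (auto simp: lookup_add lookup_minus lookup_single when_def)
    have "(\<Sum>i\<in>UNIV. Poly_Mapping.lookup \<alpha> i) = (\<Sum>i\<in>UNIV. Poly_Mapping.lookup \<beta> i) + 1"
      by (simp add: \<alpha> lookup_add sum.distrib lookup_single when_def)
    then have "P (Poly_Mapping.single \<beta> c * var i)" using Suc var mult by simp
    then show ?case by (simp add: \<alpha> var_def mult_single)
  qed
next
  case zero
  show ?case using const[of 0] by simp
qed (use add in auto)

definition mono_val :: "('n::finite \<Rightarrow>\<^sub>0 nat) \<Rightarrow> 'a::real_normed_field ^ 'n \<Rightarrow> 'a" where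
  "mono_val \<alpha> x = (\<Prod>i\<in>UNIV. (x $ i) ^ Poly_Mapping.lookup \<alpha> i)"

lemma ev_superset:
  assumes "finite K" "Poly_Mapping.keys p \<subseteq> K"
  shows "ev p x = (\<Sum>\<alpha>\<in>K. of_real (Poly_Mapping.lookup p \<alpha>) * mono_val \<alpha> x)"
  unfolding ev_def mono_val_def using assms
  by (intro sum.mono_neutral_left) (auto simp: in_keys_iff)

lemma ev_add [simp]: "ev (p + q) x = ev p x + ev q x"
proof -
  let ?K = "Poly_Mapping.keys p \<union> Poly_Mapping.keys q"
  have "Poly_Mapping.keys (p + q) \<subseteq> ?K" by (rule keys_add)
  then show ?thesis
    by (subst (1 2 3) ev_superset[of ?K]) (auto simp: lookup_add algebra_simps sum.distrib)
qed

lemma ev_zero [simp]: "ev 0 x = 0"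
  by (simp add: ev_def)

lemma ev_single: "ev (Poly_Mapping.single \<alpha> c) x = of_real c * mono_val \<alpha> x"
  by (subst ev_superset[of "{\<alpha>}"]) auto

lemma ev_sum [simp]: "ev (sum f A) x = (\<Sum>a\<in>A. ev (f a) x)"
  by (induction A rule: infinite_finite_induct) auto

lemma ev_mult [simp]: "ev (p * q) x = ev p x * ev q x"
proof (induction p rule: rpoly_add_induct)
  case (monom \<alpha> c)
  show ?case
  proof (induction q rule: rpoly_add_induct)
    case (monom \<beta> e)
    show ?case
      by (simp add: mult_single ev_single mono_val_def lookup_add power_add prod.distrib)
  qed (auto simp: algebra_simps)
qed (auto simp: algebra_simps)

lemma ev_const [simp]: "ev (Poly_Mapping.single 0 c) x = of_real c"
  by (simp add: ev_single mono_val_def)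

lemma ev_scale [simp]: "ev (scale c p) x = of_real c * ev p x"
  by (simp add: scale_conv_mult)

lemma ev_one [simp]: "ev 1 x = 1"
  using ev_const[of 1 x] by simp

lemma ev_power [simp]: "ev (p ^ k) x = ev p x ^ k"
  by (induction k) auto

lemma ev_minus [simp]: "ev (- p) x = - ev p x"
  using ev_add[of p "- p" x] by (simp add: add_eq_0_iff)

lemma ev_diff [simp]: "ev (p - q) x = ev p x - ev q x"
  using ev_add[of p "- q" x] by simp

lemma ev_var [simp]: "ev (var i) x = x $ i"
proof -
  have "mono_val (Poly_Mapping.single i 1) x = (\<Prod>j\<in>UNIV. if j = i then x $ i else 1)"
    unfolding mono_val_def by (intro prod.cong) (auto simp: lookup_single when_def)
  then show ?thesis by (simp add: var_def ev_single)
qed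

lemma ev_cvec: "ev p (cvec v) = complex_of_real (ev p v)"
  by (induction p rule: rpoly_ring_induct) (auto simp: cvec_def)

lemma ev_cnj_vec: "ev p (cnj_vec z) = cnj (ev p z)"
  by (induction p rule: rpoly_ring_induct) (auto simp: cnj_vec_def)

section \<open>Homogeneous forms and their dimension\<close>

lemma subspace_forms: "rp.subspace (forms k)"
  unfolding rp.subspace_def forms_def
proof (intro conjI ballI allI)
  fix p q :: "'n rpoly"
  assume "p \<in> {p. \<forall>\<alpha>\<in>Poly_Mapping.keys p. (\<Sum>i\<in>UNIV. Poly_Mapping.lookup \<alpha> i) = k}"
    "q \<in> {p. \<forall>\<alpha>\<in>Poly_Mapping.keys p. (\<Sum>i\<in>UNIV. Poly_Mapping.lookup \<alpha> i) = k}"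
  then show "p + q \<in> {p. \<forall>\<alpha>\<in>Poly_Mapping.keys p. (\<Sum>i\<in>UNIV. Poly_Mapping.lookup \<alpha> i) = k}"
    using keys_add[of p q] by blast
qed (auto simp: in_keys_iff)

lemmas forms_add = rp.subspace_add[OF subspace_forms]
  and forms_scale = rp.subspace_scale[OF subspace_forms]
  and forms_diff = rp.subspace_diff[OF subspace_forms]
  and forms_sum = rp.subspace_sum[OF subspace_forms]

lemma forms_mult: "p \<in> forms j \<Longrightarrow> q \<in> forms k \<Longrightarrow> p * q \<in> forms (j + k)"
  unfolding forms_def using keys_mult[of p q] by (auto simp: lookup_add sum.distrib dest!: subsetD)

lemma var_forms: "var i \<in> forms 1"
  by (auto simp: var_def forms_def lookup_single when_def)

lemma one_forms: "1 \<in> forms 0"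
  by (auto simp: forms_def)

lemma forms_power: "p \<in> forms j \<Longrightarrow> p ^ k \<in> forms (k * j)"
  by (induction k) (auto simp: one_forms forms_mult)

lemma ev_homogeneous:
  assumes "p \<in> forms k"
  shows "ev p (c *s x) = c ^ k * ev p x"
proof -
  have "mono_val \<alpha> (c *s x) = c ^ k * mono_val \<alpha> x" if "\<alpha> \<in> Poly_Mapping.keys p" for \<alpha>
  proof -
    have "mono_val \<alpha> (c *s x) = c ^ (\<Sum>i\<in>UNIV. Poly_Mapping.lookup \<alpha> i) * mono_val \<alpha> x"
      by (simp add: mono_val_def power_mult_distrib prod.distrib power_sum)
    then show ?thesis using assms that by (simp add: forms_def)
  qed
  then show ?thesis
    unfolding ev_def mono_val_def[symmetric] by (simp add: sum_distrib_left algebra_simps)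
qed

definition linear_form :: "real ^ 'n::finite \<Rightarrow> 'n rpoly" where
  "linear_form a = (\<Sum>i\<in>UNIV. scale (a $ i) (var i))"

lemma linear_form_forms: "linear_form a \<in> forms 1"
  unfolding linear_form_def by (intro forms_sum forms_scale var_forms)

lemma ev_linear_form: "ev (linear_form a) x = (\<Sum>i\<in>UNIV. of_real (a $ i) * x $ i)"
  by (simp add: linear_form_def)

text \<open>Monomials span; reading exponents along an enumeration of the variables turns them into
  lists with prescribed length and sum, which are counted by stars and bars.\<close>

lemma forms_span:
  obtains S :: "'n::finite rpoly set" where "finite S" "card S \<le> (k + CARD('n) - 1) choose k"
    "rp.span S = forms k"
proof -
  define A where "A = {\<alpha> :: 'n \<Rightarrow>\<^sub>0 nat. (\<Sum>i\<in>UNIV. Poly_Mapping.lookup \<alpha> i) = k}"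
  define B where "B = {l::nat list. length l = CARD('n) \<and> sum_list l = k}"
  obtain h where h: "bij_betw h {0..<CARD('n)} (UNIV :: 'n set)"
    using ex_bij_betw_nat_finite[OF finite_class.finite_UNIV] by blast
  define g where "g = (\<lambda>\<alpha> :: 'n \<Rightarrow>\<^sub>0 nat. map (\<lambda>i. Poly_Mapping.lookup \<alpha> (h i)) [0..<CARD('n)])"
  have finB: "finite B"
  proof -
    have "B \<subseteq> {l. set l \<subseteq> {0..k} \<and> length l = CARD('n)}"
      using member_le_sum_list by (fastforce simp: B_def)
    then show ?thesis using finite_lists_length_eq finite_subset by blast
  qed
  have inj: "inj_on g A"
  proof (rule inj_onI, rule poly_mapping_eqI)
    fix \<alpha> \<beta> j assume eq: "g \<alpha> = g \<beta>"
    obtain i where "i < CARD('n)" "j = h i"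
      using h by (metis UNIV_I bij_betw_imp_surj_on atLeastLessThan_iff imageE)
    then show "Poly_Mapping.lookup \<alpha> j = Poly_Mapping.lookup \<beta> j"
      using eq by (simp add: g_def)
  qed
  have "g ` A \<subseteq> B"
    using sum.reindex_bij_betw[OF h]
    by (auto simp: g_def A_def B_def sum_list_sum_nth)
  then have finA: "finite A" and cardA: "card A \<le> card B"
    using inj finB by (metis finite_imageD finite_subset) (use \<open>g ` A \<subseteq> B\<close> inj finB card_inj_on_le in blast)
  define S where "S = (\<lambda>\<alpha>. Poly_Mapping.single \<alpha> (1::real)) ` A"
  have "p \<in> rp.span S" if "p \<in> forms k" for p
  proof -
    have "Poly_Mapping.single \<alpha> (Poly_Mapping.lookup p \<alpha>) \<in> rp.span S" if "\<alpha> \<in> Poly_Mapping.keys p" for \<alpha>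
    proof -
      have "\<alpha> \<in> A" using that \<open>p \<in> forms k\<close> by (simp add: A_def forms_def)
      then have "scale (Poly_Mapping.lookup p \<alpha>) (Poly_Mapping.single \<alpha> 1) \<in> rp.span S"
        by (intro rp.span_scale rp.span_base) (simp add: S_def)
      then show ?thesis by (simp add: scale_conv_mult mult_single)
    qed
    then show ?thesis by (subst rpoly_sum_monomials) (rule rp.span_sum)
  qed
  moreover have "S \<subseteq> forms k" by (auto simp: S_def A_def forms_def)
  ultimately have "rp.span S = forms k" using rp.span_minimal[OF _ subspace_forms] by blast
  moreover have "finite S" "card S \<le> (k + CARD('n) - 1) choose k"
    using finA cardA card_image_le[OF finA] card_length_sum_list[of "CARD('n)" k]
    unfolding S_def B_def by (auto intro: le_trans)
  ultimately show ?thesis using that by blast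
qed

subsection \<open>Gradients\<close>

lemma ev_line_differentiable:
  fixes z h :: "complex ^ 'n::finite"
  shows "(\<lambda>t. ev p (z + t *s h)) field_differentiable (at t)"
  by (induction p rule: rpoly_ring_induct) (auto intro!: derivative_intros)

lemma axis_conv_scale: "axis i t = t *s axis i (1::complex)"
  by (simp add: vec_eq_iff axis_def)

lemma grad_nth: "grad p z $ i = deriv (\<lambda>t. ev p (z + t *s axis i 1)) 0"
  unfolding grad_def by (subst axis_conv_scale) simp

lemma grad_const: "grad (Poly_Mapping.single 0 c) z = 0"
  by (simp add: vec_eq_iff grad_nth)

lemma grad_var: "grad (var j) z = axis j 1"
proof -
  have "deriv (\<lambda>t. z $ j + t * axis i 1 $ j) 0 = axis i 1 $ j" for i
    by (rule DERIV_imp_deriv) (auto intro!: derivative_eq_intros)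
  then show ?thesis by (simp add: vec_eq_iff grad_nth) (simp add: axis_def)
qed

lemma grad_add: "grad (p + q) z = grad p z + grad q z"
  by (simp add: vec_eq_iff grad_nth ev_line_differentiable)

lemma grad_mult: "grad (p * q) z = ev p z *s grad q z + ev q z *s grad p z"
  by (simp add: vec_eq_iff grad_nth ev_line_differentiable mult.commute)

lemma grad_scale: "grad (scale c p) z = of_real c *s grad p z"
  by (simp add: scale_conv_mult grad_mult grad_const)

lemma grad_sum: "grad (sum f A) z = (\<Sum>a\<in>A. grad (f a) z)"
  using grad_const[of 0 z]
  by (induction A rule: infinite_finite_induct) (auto simp: grad_add)

lemma grad_cong: "(\<And>x :: complex ^ 'n::finite. ev p x = ev q x) \<Longrightarrow> grad p z = grad q z"
  by (simp add: grad_def)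

lemma grad_linear_form: "grad (linear_form a) z = cvec a"
  by (simp add: linear_form_def grad_sum grad_scale grad_var vec_eq_iff cvec_def axis_def if_distrib cong: if_cong)

lemma ev_line_has_derivative:
  "((\<lambda>t. ev p (z + t *s h)) has_field_derivative (\<Sum>i\<in>UNIV. h $ i * grad p z $ i)) (at 0)"
proof (induction p rule: rpoly_ring_induct)
  case (var i)
  show ?case by (auto simp: grad_var axis_def if_distrib cong: if_cong intro!: derivative_eq_intros)
next
  case (mult p q)
  show ?case
    using DERIV_mult[OF mult.IH]
    by (simp add: grad_mult sum_distrib_left sum_distrib_right sum.distrib algebra_simps)
qed (auto simp: grad_const grad_add sum.distrib algebra_simps intro!: derivative_eq_intros)

lemma grad_cvec_real: "grad p (cvec v) $ i \<in> \<real>"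
  by (induction p rule: rpoly_ring_induct)
    (auto simp: grad_const grad_var grad_add grad_mult ev_cvec axis_def)

text \<open>Euler's identity at a zero: \<open>p\<close> vanishes on the whole line through
  \<open>0\<close> and \<open>z\<close>, so its derivative at \<open>z\<close> in direction
  \<open>z\<close> is 0.\<close>

lemma euler_zero:
  assumes "p \<in> forms k" "ev p z = 0"
  shows "(\<Sum>i\<in>UNIV. z $ i * grad p z $ i) = 0"
proof -
  have "(\<lambda>t. ev p (z + t *s z)) = (\<lambda>t. 0)"
  proof
    fix t
    have "z + t *s z = (1 + t) *s z" by (simp add: vec_eq_iff algebra_simps)
    then show "ev p (z + t *s z) = 0" using assms ev_homogeneous[of p k "1 + t" z] by simp
  qed
  then have "((\<lambda>t. 0) has_field_derivative (\<Sum>i\<in>UNIV. z $ i * grad p z $ i)) (at 0)"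
    using ev_line_has_derivative[of p z z] by simp
  then show ?thesis using DERIV_unique DERIV_const by blast
qed

text \<open>Along \<open>z + t *s h\<close> each factor is \<open>t\<close> times a difference
  quotient. Dividing the relation by \<open>t * t\<close> and letting \<open>t\<close> tend to 0
  leaves the same quadratic relation between the derivatives.\<close>

lemma quadratic_relation_tangent:
  assumes A: "finite A" and F: "\<And>j k. (j, k) \<in> A \<Longrightarrow> ev (F j) z = 0 \<and> ev (F k) z = 0"
    and rel: "\<And>x. (\<Sum>(j, k)\<in>A. m j k * (ev (F j) x * ev (F k) x)) = 0"
  shows "(\<Sum>(j, k)\<in>A. m j k * ((\<Sum>i\<in>UNIV. h $ i * grad (F j) z $ i) * (\<Sum>i\<in>UNIV. h $ i * grad (F k) z $ i))) = 0"
proof -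
  define y where "y = (\<lambda>j. \<Sum>i\<in>UNIV. h $ i * grad (F j) z $ i)"
  define q where "q = (\<lambda>j t. ev (F j) (z + t *s h) / t)"
  have q: "(q j \<longlongrightarrow> y j) (at 0)" if "ev (F j) z = 0" for j
    using ev_line_has_derivative[of "F j" z h] that
    by (simp add: has_field_derivative_iff q_def y_def)
  have "((\<lambda>t. \<Sum>(j, k)\<in>A. m j k * (q j t * q k t)) \<longlongrightarrow> (\<Sum>(j, k)\<in>A. m j k * (y j * y k))) (at 0)"
    using F by (auto simp: case_prod_beta intro!: tendsto_intros q)
  moreover have "(\<Sum>(j, k)\<in>A. m j k * (q j t * q k t)) = 0" for t
  proof -
    have "(\<Sum>(j, k)\<in>A. m j k * (q j t * q k t))
      = (\<Sum>(j, k)\<in>A. m j k * (ev (F j) (z + t *s h) * ev (F k) (z + t *s h))) / (t * t)"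
      by (simp add: q_def sum_divide_distrib case_prod_beta)
    then show ?thesis using rel by simp
  qed
  ultimately have "(\<Sum>(j, k)\<in>A. m j k * (y j * y k)) = 0" by (simp add: tendsto_const_iff)
  then show ?thesis by (simp add: y_def)
qed

definition grad_independent :: "nat \<Rightarrow> (nat \<Rightarrow> 'n::finite rpoly) \<Rightarrow> complex ^ 'n \<Rightarrow> bool" where
  "grad_independent r F z \<longleftrightarrow> (\<forall>c. (\<Sum>j=1..r. c j *s grad (F j) z) = 0 \<longrightarrow> (\<forall>j\<in>{1..r}. c j = 0))"

lemma grad_independentD:
  "grad_independent r F z \<Longrightarrow> (\<Sum>j=1..r. c j *s grad (F j) z) = 0 \<Longrightarrow> j \<in> {1..r} \<Longrightarrow> c j = 0"
  by (auto simp: grad_independent_def)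

lemma independent_imp_grad_independent:
  assumes "inj_on (\<lambda>j. grad (F j) z) {1..r}" "vec.independent ((\<lambda>j. grad (F j) z) ` {1..r})"
  shows "grad_independent r F z"
  unfolding grad_independent_def
proof (intro allI impI ballI)
  fix c j
  let ?g = "\<lambda>j. grad (F j) z"
  assume 0: "(\<Sum>j=1..r. c j *s ?g j) = 0" and j: "j \<in> {1..r}"
  define c' where "c' = (\<lambda>w. c (the_inv_into {1..r} ?g w))"
  have c': "c' (?g i) = c i" if "i \<in> {1..r}" for i
    using that assms(1) unfolding c'_def by (subst the_inv_into_f_f) auto
  have "(\<Sum>w\<in>?g ` {1..r}. c' w *s w) = (\<Sum>i=1..r. c' (?g i) *s ?g i)"
    by (rule sum.reindex[OF assms(1), unfolded o_def])
  also have "\<dots> = 0" using 0 c' by (metis (no_types, lifting) sum.cong)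
  finally have "c' (?g j) = 0"
    using vec.independentD[OF assms(2) finite_imageI[OF finite_atLeastAtMost] order.refl] j by blast
  then show "c j = 0" using c' j by simp
qed

text \<open>Pairings with independent gradients are independent functionals, as testing on the axis
  vectors shows, so \<open>dual_family\<close> applies over the complex field.\<close>

lemma grad_dual_vectors:
  assumes "grad_independent r F z"
  obtains h where "\<And>j k. j \<in> {1..r} \<Longrightarrow> k \<in> {1..r} \<Longrightarrow>
    (\<Sum>i\<in>UNIV. h j $ i * grad (F k) z $ i) = (if k = j then 1 else 0)"
proof -
  define f where "f = (\<lambda>k h. \<Sum>i\<in>UNIV. h $ i * grad (F k) z $ i)"
  have "\<exists>e. \<forall>j\<in>{1..r}. e j \<in> UNIV \<and> (\<forall>i\<in>{1..r}. f i (e j) = (if i = j then 1 else 0))"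
  proof (rule vec.dual_family)
    fix i show "vec.functional_on UNIV (f i)"
      by (auto simp: vec.functional_on_def f_def algebra_simps sum.distrib sum_distrib_left)
  next
    fix c assume 0: "\<forall>x\<in>UNIV. (\<Sum>i=1..r. c i * f i x) = 0"
    have "(\<Sum>j=1..r. c j *s grad (F j) z) $ i = (\<Sum>j=1..r. c j * f j (axis i 1))" for i
      by (simp add: f_def axis_def if_distrib[of "\<lambda>x. x * _"] cong: if_cong)
    then have "(\<Sum>j=1..r. c j *s grad (F j) z) = 0" using 0 by (simp add: vec_eq_iff)
    then show "\<forall>i\<in>{1..r}. c i = 0" using assms grad_independentD by blast
  qed auto
  then show ?thesis using that unfolding f_def by blast
qed

subsection \<open>Evaluations at the points\<close>

text \<open>One point of the conjugate pair is enough in \<open>pts\<close>, as real polynomials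
  vanishing at \<open>z\<close> vanish at its conjugate. In \<open>z_nonreal\<close>,
  \<open>k\<close> and \<open>y\<close> are arbitrary, so \<open>z\<close> is also nonzero. That the
  \<open>u i\<close> are nonzero is derived in \<open>u_nonzero\<close>.\<close>

locale cb_configuration =
  fixes d r s :: nat and F :: "nat \<Rightarrow> 'n::finite rpoly"
    and v :: "nat \<Rightarrow> real ^ 'n" and z :: "complex ^ 'n" and u :: "nat \<Rightarrow> real"
    and pts :: "(complex ^ 'n) set"
  defines "pts \<equiv> insert z ((\<lambda>i. cvec (v i)) ` {1..s - 2})"
  assumes params: "CARD('n) = 3 \<and> d = 3 \<and> r = 2 \<and> s = 9 \<or> CARD('n) = 4 \<and> d = 2 \<and> r = 3 \<and> s = 8"
    and F_forms: "j \<in> {1..r} \<Longrightarrow> F j \<in> forms d"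
    and F_pts: "j \<in> {1..r} \<Longrightarrow> x \<in> pts \<Longrightarrow> ev (F j) x = 0"
    and transversal: "x \<in> pts \<Longrightarrow> grad_independent r F x"
    and v_nonzero: "i \<in> {1..s - 2} \<Longrightarrow> v i \<noteq> 0"
    and z_nonreal: "z \<noteq> k *s cvec y"
    and relation: "eval_relation d (s - 2) v z (\<lambda>i. complex_of_real (u i)) 1 1"
    and unique: "eval_relation d (s - 2) v z w b c \<Longrightarrow>
      \<exists>k. (\<forall>i\<in>{1..s - 2}. w i = k * complex_of_real (u i)) \<and> b = k \<and> c = k"
begin

definition vanishes :: "'n rpoly \<Rightarrow> bool" where
  "vanishes p \<longleftrightarrow> (\<forall>x\<in>pts. ev p x = 0)"

text \<open>Real coordinates of the values at the points: a conjugate pair contributes the real and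
  the imaginary part of the value at \<open>z\<close>.\<close>

definition phi :: "nat \<Rightarrow> 'n rpoly \<Rightarrow> real" where
  "phi k p = (if k \<le> s - 2 then ev p (v k) else if k = s - 1 then Re (ev p z) else Im (ev p z))"

lemma s_eq: "s = Suc (Suc (s - 2))" "s - 1 = Suc (s - 2)"
  using params by auto

lemma s_facts: "1 \<le> s - 2" "2 \<le> s - 2" "1 \<in> {1..s - 2}" "2 \<in> {1..s - 2}" "2 \<le> d" "1 \<le> r" "2 \<le> r"
  using params by auto

lemma pts_mem: "i \<in> {1..s - 2} \<Longrightarrow> cvec (v i) \<in> pts" "z \<in> pts"
  by (auto simp: pts_def)

lemma phi_simps:
  "i \<in> {1..s - 2} \<Longrightarrow> phi i p = ev p (v i)" "phi (s - 1) p = Re (ev p z)" "phi (s - Suc 0) p = Re (ev p z)"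
  "phi s p = Im (ev p z)"
  using params by (auto simp: phi_def)

lemma phi_linear [simp]:
  "phi k (p + q) = phi k p + phi k q" "phi k (scale c p) = c * phi k p" "phi k 0 = 0"
  "phi k (sum f A) = (\<Sum>a\<in>A. phi k (f a))"
  by (auto simp: phi_def)

lemma functional_phi: "rp.functional_on V (phi k)"
  by (auto simp: rp.functional_on_def)

lemma sum_phi:
  "(\<Sum>k=1..s. c k * phi k p)
    = (\<Sum>i=1..s - 2. c i * ev p (v i)) + c (s - 1) * Re (ev p z) + c s * Im (ev p z)"
proof -
  have "(\<Sum>k=1..s. c k * phi k p) = (\<Sum>k=1..s - 2. c k * phi k p) + c (s - 1) * phi (s - 1) p + c s * phi s p"
  proof -
    obtain m where m: "s = Suc (Suc m)" using s_eq by blast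
    show ?thesis unfolding m by (simp add: algebra_simps)
  qed
  also have "(\<Sum>k=1..s - 2. c k * phi k p) = (\<Sum>i=1..s - 2. c i * ev p (v i))"
    by (intro sum.cong) (auto simp: phi_simps)
  finally show ?thesis by (simp add: phi_simps)
qed

lemma vanishes_iff: "vanishes p \<longleftrightarrow> (\<forall>k\<in>{1..s}. phi k p = 0)"
proof
  assume "vanishes p"
  then show "\<forall>k\<in>{1..s}. phi k p = 0"
    by (auto simp: vanishes_def pts_def phi_def ev_cvec)
next
  assume *: "\<forall>k\<in>{1..s}. phi k p = 0"
  then have "phi (s - 1) p = 0" "phi s p = 0" using params by auto
  then have "ev p z = 0" by (simp add: phi_simps complex_eq_iff)
  moreover have "ev p (v i) = 0" if "i \<in> {1..s - 2}" for i
  proof -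
    have "i \<in> {1..s}" using that by auto
    then show ?thesis using * phi_simps(1)[OF that] by metis
  qed
  ultimately show "vanishes p"
    by (auto simp: vanishes_def pts_def ev_cvec)
qed

lemma vanishes_F: "j \<in> {1..r} \<Longrightarrow> vanishes (F j)"
  by (simp add: vanishes_def F_pts)

lemma vanishes_mult: "vanishes p \<Longrightarrow> vanishes (p * q)"
  by (simp add: vanishes_def)

lemma real_relation:
  assumes "f \<in> forms d"
  shows "(\<Sum>i=1..s - 2. u i * ev f (v i)) + 2 * Re (ev f z) = 0"
proof -
  have "(\<Sum>i=1..s - 2. complex_of_real (u i) * complex_of_real (ev f (v i))) + ev f z + cnj (ev f z) = 0"
    using relation assms by (auto simp: eval_relation_def ev_cnj_vec)
  from arg_cong[OF this, of Re] show ?thesis by simp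
qed

text \<open>A real relation is a complex one whose coefficients at \<open>z\<close> and its
  conjugate are conjugate. Uniqueness makes them equal, hence real.\<close>

lemma phi_relation:
  assumes "\<And>f. f \<in> forms d \<Longrightarrow> (\<Sum>k=1..s. c k * phi k f) = 0"
  shows "\<exists>\<kappa>. (\<forall>i\<in>{1..s - 2}. c i = \<kappa> * u i) \<and> c (s - 1) = 2 * \<kappa> \<and> c s = 0"
proof -
  \<comment> \<open>Chosen so that \<open>b * w + cnj b * cnj w\<close> equals
    \<open>c (s - 1) * Re w + c s * Im w\<close>.\<close>
  define b where "b = Complex (c (s - 1) / 2) (- c s / 2)"
  have "eval_relation d (s - 2) v z (\<lambda>i. complex_of_real (c i)) b (cnj b)"
    unfolding eval_relation_def ev_cnj_vec
  proof
    fix f :: "'n rpoly" assume "f \<in> forms d"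
    then have "(\<Sum>i=1..s - 2. c i * ev f (v i)) + c (s - 1) * Re (ev f z) + c s * Im (ev f z) = 0"
      using assms sum_phi by metis
    then show "(\<Sum>i=1..s - 2. complex_of_real (c i) * complex_of_real (ev f (v i))) + b * ev f z + cnj b * cnj (ev f z) = 0"
      by (simp add: complex_eq_iff b_def algebra_simps)
  qed
  then obtain k where k: "\<forall>i\<in>{1..s - 2}. complex_of_real (c i) = k * complex_of_real (u i)" "b = k" "cnj b = k"
    using unique by blast
  then have "Im b = - Im b" by (metis cnj.sel(2))
  then have "k = complex_of_real (Re k)" using k(2) by (simp add: complex_eq_iff)
  then obtain \<kappa> where \<kappa>: "k = complex_of_real \<kappa>" by blast
  then have "c (s - 1) = 2 * \<kappa>" "c s = 0" using k by (auto simp: b_def complex_eq_iff)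
  moreover have "c i = \<kappa> * u i" if "i \<in> {1..s - 2}" for i
    using k(1) that \<kappa> by (metis of_real_eq_iff of_real_mult)
  ultimately show ?thesis by blast
qed

text \<open>The real part at \<open>z\<close> is the functional to omit: its coefficient in the
  relation is 2, whatever the \<open>u i\<close> are, so a relation without it is zero.\<close>

lemma phi_independent_d:
  assumes "\<And>f. f \<in> forms d \<Longrightarrow> (\<Sum>k\<in>{1..s} - {s - 1}. c k * phi k f) = 0"
  shows "\<forall>k\<in>{1..s} - {s - 1}. c k = 0"
proof -
  define c' where "c' = c(s - 1 := 0)"
  have s1: "s - 1 \<in> {1..s}" using params by auto
  have "(\<Sum>k=1..s. c' k * phi k f) = 0" if "f \<in> forms d" for f
  proof -
    have "(\<Sum>k=1..s. c' k * phi k f) = (\<Sum>k\<in>{1..s} - {s - 1}. c' k * phi k f)"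
      using s1 by (subst sum.remove[of _ "s - 1"]) (auto simp: c'_def)
    also have "\<dots> = (\<Sum>k\<in>{1..s} - {s - 1}. c k * phi k f)"
      by (intro sum.cong) (auto simp: c'_def)
    finally show ?thesis using assms that by simp
  qed
  then obtain \<kappa> where \<kappa>: "\<forall>i\<in>{1..s - 2}. c' i = \<kappa> * u i" "c' (s - 1) = 2 * \<kappa>" "c' s = 0"
    using phi_relation by blast
  show ?thesis
  proof
    fix k assume k: "k \<in> {1..s} - {s - 1}"
    then have "k = s \<or> k \<in> {1..s - 2}" by auto
    moreover have "\<kappa> = 0" using \<kappa>(2) by (simp add: c'_def)
    ultimately have "c' k = 0" using \<kappa> by auto
    then show "c k = 0" using k by (simp add: c'_def)
  qed
qed

text \<open>The relation is the only constraint on values: the \<open>s - 1\<close> functionals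
  other than the real part at \<open>z\<close> are independent and take arbitrary values, and the
  relation then fixes that real part.\<close>

lemma interpolation:
  assumes "(\<Sum>i=1..s - 2. u i * x i) + 2 * Re w = 0"
  obtains f where "f \<in> forms d" "\<And>i. i \<in> {1..s - 2} \<Longrightarrow> ev f (v i) = x i" "ev f z = w"
proof -
  let ?I = "{1..s} - {s - 1}"
  have "\<exists>e. \<forall>j\<in>?I. e j \<in> forms d \<and> (\<forall>i\<in>?I. phi i (e j) = (if i = j then 1 else 0))"
    using phi_independent_d by (intro rp.dual_family subspace_forms functional_phi) auto
  then obtain e where e: "\<And>j. j \<in> ?I \<Longrightarrow> e j \<in> forms d"
    "\<And>i j. i \<in> ?I \<Longrightarrow> j \<in> ?I \<Longrightarrow> phi i (e j) = (if i = j then 1 else 0)" by blast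
  define y where "y = (\<lambda>k. if k = s then Im w else x k)"
  define f where "f = (\<Sum>j\<in>?I. scale (y j) (e j))"
  have f: "f \<in> forms d" unfolding f_def by (intro forms_sum forms_scale e)
  have phif: "phi i f = y i" if "i \<in> ?I" for i
  proof -
    have "phi i f = (\<Sum>j\<in>?I. if i = j then y j else 0)"
      unfolding f_def phi_linear using that by (intro sum.cong) (auto simp: e)
    then show ?thesis using that by simp
  qed
  have fv: "ev f (v i) = x i" if i: "i \<in> {1..s - 2}" for i
  proof -
    have "i \<in> ?I" "i \<noteq> s" using i s_eq by auto
    then show ?thesis using phif[of i] phi_simps(1)[OF i] by (simp add: y_def)
  qed
  have "phi s f = y s" using params by (intro phif) auto
  then have "Im (ev f z) = Im w" by (simp add: y_def phi_simps)
  moreover have "(\<Sum>i=1..s - 2. u i * ev f (v i)) = (\<Sum>i=1..s - 2. u i * x i)"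
    using fv by (intro sum.cong) auto
  then have "Re (ev f z) = Re w" using real_relation[OF f] assms by simp
  ultimately show ?thesis using that f fv by (simp add: complex_eq_iff)
qed

text \<open>Since \<open>z\<close> is not a multiple of a real vector, its real and imaginary parts
  are linearly independent; real linear forms then reach every complex value.\<close>

lemma linear_form_value_z:
  obtains a where "ev (linear_form a) z = c"
proof -
  have "z \<noteq> 0 *s cvec 0" using z_nonreal by blast
  then have "z \<noteq> 0" by simp
  then obtain i where i: "z $ i \<noteq> 0" by (metis vec_eq_iff zero_index)
  have "\<exists>j. Im (z $ j / z $ i) \<noteq> 0"
  proof (rule ccontr)
    assume "\<not> ?thesis"
    then have "z = (z $ i) *s cvec (\<chi> j. Re (z $ j / z $ i))"
      using i by (simp add: vec_eq_iff cvec_def complex_is_Real_iff[symmetric])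
    then show False using z_nonreal by blast
  qed
  then obtain j where j: "Im (z $ j / z $ i) \<noteq> 0" by blast
  \<comment> \<open>A nonzero 2 by 2 minor of the real and imaginary parts of \<open>z\<close>; the
    coefficients of \<open>a\<close> come from Cramer's rule.\<close>
  define D where "D = Re (z $ i) * Im (z $ j) - Im (z $ i) * Re (z $ j)"
  have D: "D \<noteq> 0" using j by (auto simp: D_def Im_divide algebra_simps)
  define a where "a = axis i ((Re c * Im (z $ j) - Im c * Re (z $ j)) / D)
    + axis j ((Re (z $ i) * Im c - Im (z $ i) * Re c) / D)"
  have "ev (linear_form a) z
    = of_real ((Re c * Im (z $ j) - Im c * Re (z $ j)) / D) * z $ i
    + of_real ((Re (z $ i) * Im c - Im (z $ i) * Re c) / D) * z $ j"
    by (simp add: ev_linear_form a_def algebra_simps sum.distrib axis_def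
      if_distrib[of of_real] if_distrib[of "\<lambda>x. _ * x"] cong: if_cong)
  also have "\<dots> = c"
    using D by (simp add: complex_eq_iff field_simps) (simp add: D_def algebra_simps)
  finally show ?thesis using that by blast
qed

lemma form_value_z:
  assumes "1 \<le> m"
  obtains q where "q \<in> forms m" "ev q z = c"
proof -
  obtain a where a: "ev (linear_form a) z = c" by (rule linear_form_value_z)
  obtain b where b: "ev (linear_form b) z = 1" by (rule linear_form_value_z)
  have "linear_form a * linear_form b ^ (m - 1) \<in> forms (1 + (m - 1) * 1)"
    by (intro forms_mult forms_power linear_form_forms)
  then show ?thesis using a b assms by (intro that[of "linear_form a * linear_form b ^ (m - 1)"]) auto
qed

text \<open>Multiplying forms of degree \<open>d\<close> by a fixed \<open>q\<close> of degree
  \<open>k - d\<close> turns a relation in degree \<open>k\<close> into one in degree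
  \<open>d\<close>, weighted by the values of \<open>q\<close>. It must be a multiple of the
  Cayley-Bacharach relation; varying \<open>q\<close> kills all coefficients.\<close>

lemma phi_independent:
  assumes "d < k" and rel: "\<And>f. f \<in> forms k \<Longrightarrow> (\<Sum>i=1..s. c i * phi i f) = 0"
  shows "\<forall>i\<in>{1..s}. c i = 0"
proof -
  define b where "b = Complex (c (s - 1)) (- c s)"
  have *: "\<exists>\<kappa>. (\<forall>i\<in>{1..s - 2}. c i * ev q (v i) = \<kappa> * u i) \<and> Re (b * ev q z) = 2 * \<kappa> \<and> Im (b * ev q z) = 0"
    if q: "q \<in> forms (k - d)" for q
  proof -
    define c' where "c' = (\<lambda>i. if i = s then - Im (b * ev q z) else if i = s - 1 then Re (b * ev q z)
      else c i * ev q (v i))"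
    have c': "c' i = c i * ev q (v i)" if "i \<in> {1..s - 2}" for i
      using that s_eq by (auto simp: c'_def)
    have c's: "c' (s - 1) = Re (b * ev q z)" "c' s = - Im (b * ev q z)"
      using s_eq by (auto simp: c'_def)
    have "(\<Sum>i=1..s. c' i * phi i f) = 0" if f: "f \<in> forms d" for f
    proof -
      have "q * f \<in> forms (k - d + d)" using q f by (rule forms_mult)
      then have "(\<Sum>i=1..s. c i * phi i (q * f)) = 0" using rel assms by simp
      moreover have "(\<Sum>i=1..s - 2. c i * ev (q * f) (v i)) = (\<Sum>i=1..s - 2. c' i * ev f (v i))"
        using c' by (intro sum.cong) auto
      ultimately show ?thesis unfolding sum_phi c's by (simp add: b_def algebra_simps)
    qed
    then obtain \<kappa> where "\<forall>i\<in>{1..s - 2}. c' i = \<kappa> * u i" "c' (s - 1) = 2 * \<kappa>" "c' s = 0"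
      using phi_relation by blast
    then show ?thesis using c' c's by (intro exI[of _ \<kappa>]) auto
  qed
  have b: "b = 0"
  proof (rule ccontr)
    assume b: "b \<noteq> 0"
    have "1 \<le> k - d" using assms by simp
    \<comment> \<open>With \<open>b * ev q z = \<i>\<close> the imaginary part is 1, while a
      multiple of the relation has a real coefficient at \<open>z\<close>.\<close>
    then obtain q where "q \<in> forms (k - d)" "ev q z = \<i> / b" by (rule form_value_z)
    then show False using *[of q] b by auto
  qed
  have "c i = 0" if i: "i \<in> {1..s - 2}" for i
  proof -
    have "linear_form (v i) ^ (k - d) \<in> forms ((k - d) * 1)"
      by (intro forms_power linear_form_forms)
    \<comment> \<open>Since \<open>b = 0\<close>, the multiple is 0, so each
      \<open>c i * ev q (v i)\<close> vanishes; powers of this linear form are nonzero at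
      \<open>v i\<close>.\<close>
    then have "c i * ev (linear_form (v i) ^ (k - d)) (v i) = 0"
      using *[of "linear_form (v i) ^ (k - d)"] b i by auto
    moreover have "ev (linear_form (v i)) (v i) = v i \<bullet> v i" by (simp add: ev_linear_form inner_vec_def)
    ultimately show ?thesis using v_nonzero[OF i] by auto
  qed
  moreover have "c (s - 1) = 0" "c s = 0" using b by (auto simp: b_def complex_eq_iff)
  moreover have "i \<in> {1..s - 2} \<or> i = s - 1 \<or> i = s" if "i \<in> {1..s}" for i using that by auto
  ultimately show ?thesis by blast
qed

section \<open>Forms that vanish at all the points\<close>

text \<open>A dimension count. The vanishing forms \<open>b a\<close> and a dual family for the
  functionals in \<open>I\<close> are jointly independent and numerous enough to span
  \<open>forms k\<close>. On a vanishing form the functionals read off zero coefficients for the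
  dual family.\<close>

lemma vanishing_span:
  assumes B: "finite B" and b: "\<And>a. a \<in> B \<Longrightarrow> b a \<in> forms k" "\<And>a. a \<in> B \<Longrightarrow> vanishes (b a)"
    and ind: "\<And>c. (\<Sum>a\<in>B. scale (c a) (b a)) = 0 \<Longrightarrow> \<forall>a\<in>B. c a = 0"
    and I: "I \<subseteq> {1..s}"
    and phi: "\<And>c. (\<And>f. f \<in> forms k \<Longrightarrow> (\<Sum>i\<in>I. c i * phi i f) = 0) \<Longrightarrow> \<forall>i\<in>I. c i = 0"
    and card: "(k + CARD('n) - 1) choose k \<le> card B + card I"
    and p: "p \<in> forms k" "vanishes p"
  shows "\<exists>c. p = (\<Sum>a\<in>B. scale (c a) (b a))"
proof -
  have fI: "finite I" using I finite_subset by blast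
  obtain S :: "'n rpoly set" where S: "finite S" "card S \<le> (k + CARD('n) - 1) choose k" "rp.span S = forms k"
    by (rule forms_span)
  have "\<exists>e. \<forall>j\<in>I. e j \<in> forms k \<and> (\<forall>i\<in>I. phi i (e j) = (if i = j then 1 else 0))"
    using phi fI by (intro rp.dual_family subspace_forms functional_phi) auto
  then obtain e where e: "\<And>j. j \<in> I \<Longrightarrow> e j \<in> forms k"
    "\<And>i j. i \<in> I \<Longrightarrow> j \<in> I \<Longrightarrow> phi i (e j) = (if i = j then 1 else 0)" by blast
  define g where "g = case_sum b e"
  have split: "(\<Sum>a\<in>B <+> I. scale (c a) (g a)) =
      (\<Sum>a\<in>B. scale (c (Inl a)) (b a)) + (\<Sum>i\<in>I. scale (c (Inr i)) (e i))" for c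
    using B fI by (simp add: sum.Plus g_def)
  have coeff: "phi i (\<Sum>a\<in>B <+> I. scale (c a) (g a)) = c (Inr i)" if i: "i \<in> I" for c i
  proof -
    have "phi i (b a) = 0" if "a \<in> B" for a using b(2)[OF that] i I vanishes_iff by blast
    then have "phi i (\<Sum>a\<in>B <+> I. scale (c a) (g a)) = (\<Sum>j\<in>I. c (Inr j) * phi i (e j))"
      unfolding split by simp
    also have "\<dots> = (\<Sum>j\<in>I. if i = j then c (Inr j) else 0)"
      using i by (intro sum.cong) (auto simp: e)
    finally show ?thesis using i fI by simp
  qed
  have "\<exists>c. p = (\<Sum>a\<in>B <+> I. scale (c a) (g a))"
  proof (rule rp.spans_of_large_family[OF _ S(1)])
    show "card S \<le> card (B <+> I)" using S(2) card B fI by (simp add: card_Plus)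
    show "g ` (B <+> I) \<subseteq> rp.span S" using b e S(3) by (auto simp: g_def)
    fix c assume 0: "(\<Sum>a\<in>B <+> I. scale (c a) (g a)) = 0"
    then have I0: "c (Inr i) = 0" if "i \<in> I" for i using coeff[OF that, of c] by simp
    then have "(\<Sum>a\<in>B. scale (c (Inl a)) (b a)) = 0" using 0 unfolding split by simp
    then show "\<forall>a\<in>B <+> I. c a = 0" using I0 ind[of "\<lambda>a. c (Inl a)"] by auto
  qed (use B fI p S in auto)
  then obtain c where c: "p = (\<Sum>a\<in>B <+> I. scale (c a) (g a))" by blast
  have "c (Inr i) = 0" if "i \<in> I" for i
    using coeff[OF that, of c] p(2) that I c vanishes_iff by auto
  then have "p = (\<Sum>a\<in>B. scale (c (Inl a)) (b a))" using c unfolding split by simp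
  then show ?thesis by (rule exI[of _ "\<lambda>a. c (Inl a)"])
qed

lemma grad_combination_zero:
  assumes "(\<Sum>j=1..r. scale (c j) (F j)) = p" "x \<in> pts" "grad p x = 0" "j \<in> {1..r}"
  shows "c j = 0"
proof -
  have "(\<Sum>j=1..r. complex_of_real (c j) *s grad (F j) x) = 0"
    using assms(1,3) by (auto simp: grad_sum grad_scale)
  then show ?thesis using grad_independentD[OF transversal] assms by fastforce
qed

text \<open>At a common zero the product rule leaves a combination of independent gradients with
  coefficients \<open>ev (g j) x\<close>.\<close>

lemma syzygy_vanishes:
  assumes "\<And>x :: complex ^ 'n. (\<Sum>j=1..r. ev (F j) x * ev (g j) x) = 0" "j \<in> {1..r}"
  shows "vanishes (g j)"
  unfolding vanishes_def
proof
  fix x assume x: "x \<in> pts"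
  have "grad (\<Sum>j=1..r. F j * g j) x = grad 0 x"
    using assms by (intro grad_cong) simp
  then have "(\<Sum>j=1..r. ev (g j) x *s grad (F j) x) = 0"
    using grad_const[of 0 x] F_pts x by (simp add: grad_sum grad_mult)
  then show "ev (g j) x = 0" 
    using grad_independentD[OF transversal[OF x], of "\<lambda>j. ev (g j) x"] assms(2) by blast
qed

text \<open>The count is exact in both cases: the binomial coefficient is 10, and
  \<open>r + (s - 1)\<close> is 2 + 8 or 3 + 7.\<close>

lemma vanishing_degree_d:
  assumes "p \<in> forms d" "vanishes p"
  shows "\<exists>c. p = (\<Sum>j=1..r. scale (c j) (F j))"
proof (rule vanishing_span)
  show "\<forall>j\<in>{1..r}. c j = 0" if "(\<Sum>j=1..r. scale (c j) (F j)) = 0" for c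
    using grad_combination_zero[OF that pts_mem(2)] grad_const[of 0 z] by simp
  show "\<forall>i\<in>{1..s} - {s - 1}. c i = 0"
    if "\<And>f. f \<in> forms d \<Longrightarrow> (\<Sum>i\<in>{1..s} - {s - 1}. c i * phi i f) = 0" for c
    using phi_independent_d that by blast
  have "card ({1..s} - {s - 1}) = s - 1" using params by (subst card_Diff_singleton) auto
  then show "(d + CARD('n) - 1) choose d \<le> card {1..r} + card ({1..s} - {s - 1})"
    using params by (auto simp: numeral_eq_Suc)
qed (use assms F_forms vanishes_F in auto)

text \<open>A product of \<open>q\<close> with linear forms through \<open>v 1\<close> is a combination of the \<open>F j\<close> that is singular
  at \<open>v 1\<close>, hence zero.\<close>

lemma vanishing_low_degree:
  fixes x :: "complex ^ 'n"
  assumes q: "q \<in> forms k" "vanishes q" and "k < d"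
  shows "ev q x = 0"
proof -
  define p where "p = v 1"
  have p: "cvec p \<in> pts" "p \<noteq> 0" using pts_mem(1)[OF s_facts(3)] v_nonzero[OF s_facts(3)] by (auto simp: p_def)
  obtain i where i: "p $ i \<noteq> 0" using p by (metis vec_eq_iff zero_index)
  show ?thesis
  proof (cases "\<forall>j. of_real (p $ i) * x $ j = of_real (p $ j) * x $ i")
    case True
    then have "x = (x $ i / of_real (p $ i)) *s cvec p" using i by (simp add: vec_eq_iff cvec_def field_simps)
    moreover have "ev q (cvec p) = 0" using q p by (simp add: vanishes_def)
    ultimately show ?thesis using ev_homogeneous[OF q(1)] by (metis mult_zero_right)
  next
    case False
    then obtain j where j: "of_real (p $ i) * x $ j \<noteq> of_real (p $ j) * x $ i" by blast
    \<comment> \<open>A linear form through \<open>p\<close> that is nonzero at \<open>x\<close>;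
      both \<open>q\<close> and the power of \<open>L\<close> vanish at \<open>p\<close>, which
      makes their product singular there.\<close>
    define L where "L = linear_form (axis j (p $ i) - axis i (p $ j))"
    have L: "ev L y = of_real (p $ i) * y $ j - of_real (p $ j) * y $ i" for y :: "complex ^ 'n"
      by (simp add: L_def ev_linear_form algebra_simps sum_subtractf axis_def
        if_distrib[of of_real] if_distrib[of "\<lambda>x. _ * x"] cong: if_cong)
    have Lp: "ev L (cvec p) = 0" by (simp add: L cvec_def)
    define P where "P = q * L ^ (d - k)"
    have "P \<in> forms (k + (d - k) * 1)" unfolding P_def L_def
      by (intro forms_mult forms_power linear_form_forms q)
    moreover have "vanishes P" using q by (simp add: P_def vanishes_mult)
    ultimately obtain c where c: "P = (\<Sum>j=1..r. scale (c j) (F j))"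
      using vanishing_degree_d assms by fastforce
    have "grad P (cvec p) = 0"
      using q p Lp assms by (simp add: P_def grad_mult vanishes_def)
    then have "c j = 0" if "j \<in> {1..r}" for j using grad_combination_zero[OF c[symmetric] p(1)] that by blast
    then have "ev P x = 0" unfolding c by simp
    then show ?thesis using j by (simp add: P_def L)
  qed
qed

lemma grad_F_nonzero:
  assumes "x \<in> pts" "j \<in> {1..r}"
  shows "grad (F j) x \<noteq> 0"
proof
  assume 0: "grad (F j) x = 0"
  have "(\<Sum>i=1..r. (if i = j then 1 else 0) *s grad (F i) x) = 0"
    using 0 by (intro sum.neutral) auto
  from grad_independentD[OF transversal[OF assms(1)] this assms(2)] show False by simp
qed

end

subsection \<open>Noether's theorem and the Cayley-Bacharach coefficients\<close>

context cb_configuration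
begin

text \<open>The spanning family consists of the \<open>F j * e i\<close>, with \<open>e\<close> dual
  to all coordinates but the real part at \<open>z\<close>, and the \<open>F j * F k\<close> with
  \<open>j \<le> k\<close>. Together with the \<open>s\<close> evaluations the count is 16 + 3 + 9 =
  28 or 21 + 6 + 8 = 35, the number of monomials of degree \<open>2 * d\<close>.\<close>

lemma max_noether:
  assumes "p \<in> forms (2 * d)" "vanishes p"
  obtains g where "\<And>j. j \<in> {1..r} \<Longrightarrow> g j \<in> forms d" "p = (\<Sum>j=1..r. F j * g j)"
proof -
  let ?I = "{1..s} - {s - 1}"
  let ?T = "{(j, k). 1 \<le> j \<and> j \<le> k \<and> k \<le> r}"
  have fT: "finite ?T" by (rule finite_subset[of _ "{1..r} \<times> {1..r}"]) auto
  have "\<exists>e. \<forall>j\<in>?I. e j \<in> forms d \<and> (\<forall>i\<in>?I. phi i (e j) = (if i = j then 1 else 0))"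
    using phi_independent_d by (intro rp.dual_family subspace_forms functional_phi) auto
  then obtain e where e: "\<And>j. j \<in> ?I \<Longrightarrow> e j \<in> forms d"
    "\<And>i j. i \<in> ?I \<Longrightarrow> j \<in> ?I \<Longrightarrow> phi i (e j) = (if i = j then 1 else 0)" by blast
  define b where "b = case_sum (\<lambda>(j, i). F j * e i) (\<lambda>(j, k). F j * F k)"
  let ?B = "({1..r} \<times> ?I) <+> ?T"
  have split: "(\<Sum>a\<in>?B. scale (c a) (b a)) =
      (\<Sum>j=1..r. F j * (\<Sum>i\<in>?I. scale (c (Inl (j, i))) (e i)))
      + (\<Sum>(j, k)\<in>?T. scale (c (Inr (j, k))) (F j * F k))" for c
    using fT by (simp add: sum.Plus b_def sum_distrib_left scale_mult_right case_prod_beta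
        sum.cartesian_product)
  have T_sum: "(\<Sum>(j, k)\<in>?T. scale (c j k) (F j * F k)) = (\<Sum>j=1..r. F j * (\<Sum>k=j..r. scale (c j k) (F k)))" for c
  proof -
    have "?T = Sigma {1..r} (\<lambda>j. {j..r})" by auto
    then show ?thesis by (simp add: sum.Sigma[symmetric] sum_distrib_left scale_mult_right)
  qed
  have "\<exists>c. p = (\<Sum>a\<in>?B. scale (c a) (b a))"
  proof (rule vanishing_span[where I = "{1..s}"])
    show "finite ?B" using fT by simp
    show "b a \<in> forms (2 * d)" if a: "a \<in> ?B" for a
    proof -
      have "b a \<in> forms (d + d)"
        using a by (auto simp: b_def e F_forms intro!: forms_mult)
      then show ?thesis by (simp add: mult_2)
    qed
    show "vanishes (b a)" if a: "a \<in> ?B" for a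
      using a by (auto simp: b_def intro!: vanishes_mult vanishes_F)
    show "\<forall>i\<in>{1..s}. c i = 0" if "\<And>f. f \<in> forms (2 * d) \<Longrightarrow> (\<Sum>i=1..s. c i * phi i f) = 0" for c
      using phi_independent[of "2 * d"] that s_facts by auto
    have "?T = Sigma {1..r} (\<lambda>j. {j..r})" by auto
    then have "card ?T = (\<Sum>j=1..r. Suc r - j)" by (simp add: card_SigmaI)
    moreover have "card ?I = s - 1" using params by (subst card_Diff_singleton) auto
    ultimately have "card ?B = r * (s - 1) + (\<Sum>j=1..r. Suc r - j)" using fT by (simp add: card_Plus card_cartesian_product)
    then show "(2 * d + CARD('n) - 1) choose (2 * d) \<le> card ?B + card {1..s}"
      using params by (auto simp: numeral_eq_Suc)
    show "\<forall>a\<in>?B. c a = 0" if c: "(\<Sum>a\<in>?B. scale (c a) (b a)) = 0" for c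
    proof -
      define g where "g = (\<lambda>j. \<Sum>i\<in>?I. scale (c (Inl (j, i))) (e i))"
      \<comment> \<open>The products \<open>F j * F k\<close> enter the syzygy through cofactors
        \<open>h j\<close> that vanish at the points. So the \<open>g j\<close> vanish there too,
        and duality makes their coefficients 0.\<close>
      define h where "h = (\<lambda>j. \<Sum>k=j..r. scale (c (Inr (j, k))) (F k))"
      have rel: "(\<Sum>j=1..r. F j * g j) + (\<Sum>j=1..r. F j * h j) = 0"
        using c unfolding split T_sum[of "\<lambda>j k. c (Inr (j, k))"] g_def h_def by simp
      have hv: "vanishes (h j)" if "j \<in> {1..r}" for j
        using that F_pts by (auto simp: h_def vanishes_def)
      have Inl0: "c (Inl (j, i)) = 0" if j: "j \<in> {1..r}" and i: "i \<in> ?I" for j i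
      proof -
        have "vanishes (g j + h j)"
        proof (rule syzygy_vanishes[OF _ j])
          fix x :: "complex ^ 'n"
          have "ev ((\<Sum>j=1..r. F j * g j) + (\<Sum>j=1..r. F j * h j)) x = 0" using rel by simp
          then show "(\<Sum>j=1..r. ev (F j) x * ev (g j + h j) x) = 0"
            by (simp add: distrib_left sum.distrib)
        qed
        then have "vanishes (g j)" using hv[OF j] by (simp add: vanishes_def)
        then have "phi i (g j) = 0" using i vanishes_iff by auto
        moreover have "phi i (g j) = (\<Sum>k\<in>?I. if i = k then c (Inl (j, k)) else 0)"
          unfolding g_def phi_linear using i by (intro sum.cong) (auto simp: e)
        ultimately show ?thesis using i by simp
      qed
      have g0: "g j = 0" if "j \<in> {1..r}" for j
        unfolding g_def using Inl0 that by (intro sum.neutral) auto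
      have "(\<Sum>(j, k)\<in>?T. scale (c (Inr (j, k))) (F j * F k)) = 0"
        using rel g0 unfolding T_sum[of "\<lambda>j k. c (Inr (j, k))"] h_def by simp
      then have "ev (\<Sum>(j, k)\<in>?T. scale (c (Inr (j, k))) (F j * F k)) x = 0" for x :: "complex ^ 'n" by simp
      then have quad: "(\<Sum>(j, k)\<in>?T. complex_of_real (c (Inr (j, k))) * (ev (F j) x * ev (F k) x)) = 0" for x
        by (simp add: case_prod_beta)
      \<comment> \<open>The remaining quadratic relation among the \<open>F j\<close> is passed to
        derivatives at \<open>z\<close>. The direction \<open>t l\<close> isolates the coefficient
        of \<open>(l, l)\<close>, and then \<open>t l + t m\<close> that of
        \<open>(l, m)\<close>.\<close>
      obtain t where t: "\<And>j k. j \<in> {1..r} \<Longrightarrow> k \<in> {1..r} \<Longrightarrow>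
          (\<Sum>i\<in>UNIV. t j $ i * grad (F k) z $ i) = (if k = j then 1 else 0)"
        using grad_dual_vectors[OF transversal[OF pts_mem(2)]] by blast
      define D where "D = (\<lambda>h k. \<Sum>i\<in>UNIV. h $ i * grad (F k) z $ i)"
      have tangent: "(\<Sum>(j, k)\<in>?T. complex_of_real (c (Inr (j, k))) * (D h j * D h k)) = 0" for h
        unfolding D_def using F_pts pts_mem(2) by (intro quadratic_relation_tangent fT quad) auto
      have D: "D (t j) k = (if k = j then 1 else 0)" if "j \<in> {1..r}" "k \<in> {1..r}" for j k
        using t[OF that] by (simp add: D_def)
      have Dadd: "D (h + h') k = D h k + D h' k" for h h' k
        by (simp add: D_def algebra_simps sum.distrib)
      have diag: "c (Inr (l, l)) = 0" if l: "l \<in> {1..r}" for l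
      proof -
        have "(\<Sum>(j, k)\<in>?T. complex_of_real (c (Inr (j, k))) * (D (t l) j * D (t l) k))
          = (\<Sum>a\<in>?T. if a = (l, l) then complex_of_real (c (Inr (l, l))) else 0)"
          using D[OF l] by (intro sum.cong) (auto split: if_splits)
        also have "\<dots> = complex_of_real (c (Inr (l, l)))"
          using fT l by (subst sum.delta) auto
        finally show ?thesis using tangent by simp
      qed
      have off: "c (Inr (l, m)) = 0" if l: "l \<in> {1..r}" and m: "m \<in> {1..r}" and lm: "l < m" for l m
      proof -
        have "(\<Sum>(j, k)\<in>?T. complex_of_real (c (Inr (j, k))) * (D (t l + t m) j * D (t l + t m) k))
          = (\<Sum>a\<in>?T. if a = (l, m) then complex_of_real (c (Inr (l, m))) else 0)"
          using D[OF l] D[OF m] lm diag unfolding Dadd by (intro sum.cong) (auto split: if_splits)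
        also have "\<dots> = complex_of_real (c (Inr (l, m)))"
          using fT l m lm by (subst sum.delta) auto
        finally show ?thesis using tangent by simp
      qed
      have Inr0: "c (Inr (j, k)) = 0" if "(j, k) \<in> ?T" for j k
        using that diag[of j] off[of j k] by (cases "j = k") auto
      show ?thesis
      proof
        fix a assume "a \<in> ?B"
        then consider j i where "a = Inl (j, i)" "j \<in> {1..r}" "i \<in> ?I" | j k where "a = Inr (j, k)" "(j, k) \<in> ?T"
          by blast
        then show "c a = 0"
        proof cases
          case 1
          then show ?thesis using Inl0[OF 1(2,3)] by simp
        next
          case 2
          then show ?thesis using Inr0[OF 2(2)] by simp
        qed
      qed
    qed
  qed (use assms in auto)
  then obtain c where "p = (\<Sum>a\<in>?B. scale (c a) (b a))" by blast
  then have "p = (\<Sum>j=1..r. F j * ((\<Sum>i\<in>?I. scale (c (Inl (j, i))) (e i)) + (\<Sum>k=j..r. scale (c (Inr (j, k))) (F k))))"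
    unfolding split T_sum[of "\<lambda>j k. c (Inr (j, k))"] by (simp add: distrib_left sum.distrib)
  then show ?thesis
    by (intro that[of "\<lambda>j. (\<Sum>i\<in>?I. scale (c (Inl (j, i))) (e i)) + (\<Sum>k=j..r. scale (c (Inr (j, k))) (F k))"])
      (auto intro!: forms_add forms_sum forms_scale e F_forms)
qed

lemma linear_form_eq_0:
  assumes "vanishes (linear_form a)"
  shows "a = 0"
proof -
  have "ev (linear_form a) x = 0" for x :: "complex ^ 'n"
    using vanishing_low_degree[OF linear_form_forms assms] s_facts by simp
  then have "grad (linear_form a) z = grad 0 z" by (intro grad_cong) simp
  then show ?thesis using grad_const[of 0 z] by (simp add: grad_linear_form vec_eq_iff cvec_def)
qed

text \<open>A syzygy with linear cofactors has cofactors that vanish at the points, hence zero by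
  \<open>linear_form_eq_0\<close>. So the products of the \<open>F j\<close> with variables are
  independent, and the count is exact again: 15 = 6 + 9 or 20 = 12 + 8.\<close>

lemma max_noether_Suc:
  assumes "p \<in> forms (d + 1)" "vanishes p"
  obtains a where "p = (\<Sum>j=1..r. F j * linear_form (a j))"
proof -
  let ?B = "{1..r} \<times> (UNIV :: 'n set)"
  have split: "(\<Sum>(j, i)\<in>?B. scale (c (j, i)) (F j * var i)) = (\<Sum>j=1..r. F j * linear_form (\<chi> i. c (j, i)))" for c
    by (simp add: sum.cartesian_product[symmetric] linear_form_def sum_distrib_left scale_mult_right)
  have "\<exists>c. p = (\<Sum>a\<in>?B. scale (c a) ((\<lambda>(j, i). F j * var i) a))"
  proof (rule vanishing_span[where I = "{1..s}" and k = "d + 1"])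
    show "(case a of (j, i) \<Rightarrow> F j * var i) \<in> forms (d + 1)" if "a \<in> ?B" for a
      using that by (cases a) (auto intro!: forms_mult[of _ d _ 1, simplified] F_forms var_forms[simplified])
    show "\<forall>i\<in>{1..s}. c i = 0" if "\<And>f. f \<in> forms (d + 1) \<Longrightarrow> (\<Sum>i=1..s. c i * phi i f) = 0" for c
      using phi_independent[of "d + 1"] that by simp
    show "(d + 1 + CARD('n) - 1) choose (d + 1) \<le> card ?B + card {1..s}"
      using params by (auto simp: numeral_eq_Suc card_cartesian_product)
    show "\<forall>a\<in>?B. c a = 0" if "(\<Sum>a\<in>?B. scale (c a) ((\<lambda>(j, i). F j * var i) a)) = 0" for c
    proof -
      have 0: "(\<Sum>j=1..r. F j * linear_form (\<chi> i. c (j, i))) = 0"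
        using that split[of c] by (simp add: case_prod_beta)
      have "(\<chi> i. c (j, i)) = 0" if j: "j \<in> {1..r}" for j
      proof (rule linear_form_eq_0, rule syzygy_vanishes[OF _ j])
        fix x :: "complex ^ 'n"
        show "(\<Sum>j=1..r. ev (F j) x * ev (linear_form (\<chi> i. c (j, i))) x) = 0"
          using arg_cong[OF 0, of "\<lambda>p. ev p x"] by simp
      qed
      then show ?thesis by (auto simp: vec_eq_iff)
    qed
  qed (use assms in \<open>auto intro!: vanishes_mult vanishes_F\<close>)
  then show ?thesis using that split by (auto simp: case_prod_beta)
qed

text \<open>If \<open>u i = 0\<close>, some form \<open>f\<close> of degree \<open>d\<close> vanishes at all the points except \<open>v i\<close>. Its products
  with the tangent hyperplanes \<open>L a\<close> of the \<open>F a\<close> at \<open>v i\<close> lie in the ideal, and comparing the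
  resulting expressions for \<open>f * L a * L b\<close> gives a forbidden syzygy.\<close>

lemma u_nonzero:
  assumes i: "i \<in> {1..s - 2}"
  shows "u i \<noteq> 0"
proof
  assume ui: "u i = 0"
  define p where "p = cvec (v i)"
  have p: "p \<in> pts" using i pts_mem by (simp add: p_def)
  \<comment> \<open>The indicator of \<open>v i\<close> satisfies the relation because
    \<open>u i = 0\<close>.\<close>
  have "(\<Sum>k=1..s - 2. u k * (if k = i then 1 else 0)) + 2 * Re 0 = 0"
    using ui by (simp add: if_distrib cong: if_cong)
  then obtain f where f: "f \<in> forms d" "\<And>k. k \<in> {1..s - 2} \<Longrightarrow> ev f (v k) = (if k = i then 1 else 0)"
    "ev f z = 0" by (rule interpolation) blast
  have fp: "ev f p = 1" using f(2)[OF i] by (simp add: p_def ev_cvec)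
  \<comment> \<open>The gradient at a real point is real, so taking real parts loses
    nothing.\<close>
  define L where "L = (\<lambda>a. linear_form (\<chi> k. Re (grad (F a) p $ k)))"
  have gradL: "grad (L a) x = grad (F a) p" for a x
  proof -
    have "cvec (\<chi> k. Re (grad (F a) p $ k)) = grad (F a) p"
      using grad_cvec_real[of "F a" "v i"] by (simp add: vec_eq_iff cvec_def p_def)
    then show ?thesis by (simp add: L_def grad_linear_form)
  qed
  have L_forms: "L a \<in> forms 1" for a unfolding L_def by (rule linear_form_forms)
  have Lp: "ev (L a) p = 0" if "a \<in> {1..r}" for a
  proof -
    have "ev (L a) p = (\<Sum>k\<in>UNIV. p $ k * grad (F a) p $ k)"
      using grad_cvec_real[of "F a" "v i"] by (simp add: L_def ev_linear_form p_def mult.commute)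
    then show ?thesis using euler_zero[OF F_forms[OF that]] F_pts[OF that p] by simp
  qed
  have fL: "vanishes (f * L a)" if "a \<in> {1..r}" for a
    unfolding vanishes_def
  proof
    fix x assume "x \<in> pts"
    then consider "x = z" | k where "k \<in> {1..s - 2}" "x = cvec (v k)"
      by (auto simp: pts_def)
    then show "ev (f * L a) x = 0"
    proof cases
      case 1
      then show ?thesis using f by simp
    next
      case 2
      then show ?thesis using f(2)[OF 2(1)] Lp[OF that] by (cases "k = i") (auto simp: ev_cvec p_def)
    qed
  qed
  have "\<forall>a. \<exists>m. a \<in> {1..r} \<longrightarrow> f * L a = (\<Sum>j=1..r. F j * linear_form (m j))"
    using max_noether_Suc[OF forms_mult[OF f(1) L_forms] fL] by metis
  then obtain m where m: "\<And>a. a \<in> {1..r} \<Longrightarrow> f * L a = (\<Sum>j=1..r. F j * linear_form (m a j))"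
    by metis
  define M where "M = (\<lambda>a j. linear_form (m a j))"
  have fM: "f * L a = (\<Sum>j=1..r. F j * M a j)" if "a \<in> {1..r}" for a using m that by (simp add: M_def)
  have M_forms: "M a j \<in> forms 1" for a j unfolding M_def by (rule linear_form_forms)
  have Mp: "ev (M a j) p = (if j = a then 1 else 0)" if a: "a \<in> {1..r}" and j: "j \<in> {1..r}" for a j
  proof -
    \<comment> \<open>Comparing gradients at \<open>p\<close>, where \<open>f\<close> is 1 and
      \<open>L a\<close> is 0, gives the values of the cofactors.\<close>
    have "grad (f * L a) p = (\<Sum>j=1..r. ev (M a j) p *s grad (F j) p)"
      unfolding fM[OF a] using F_pts p by (simp add: grad_sum grad_mult)
    moreover have "grad (f * L a) p = grad (F a) p" using fp Lp[OF a] by (simp add: grad_mult gradL)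
    moreover have "(\<Sum>j=1..r. (ev (M a j) p - (if j = a then 1 else 0)) *s grad (F j) p)
      = (\<Sum>j=1..r. ev (M a j) p *s grad (F j) p) - (\<Sum>j=1..r. if j = a then grad (F j) p else 0)"
      by (subst sum_subtractf[symmetric]) (auto intro!: sum.cong simp: vec_eq_iff algebra_simps)
    ultimately have "(\<Sum>j=1..r. (ev (M a j) p - (if j = a then 1 else 0)) *s grad (F j) p) = 0"
      using a by simp
    from grad_independentD[OF transversal[OF p] this j] show ?thesis by simp
  qed
  \<comment> \<open>The two ways to expand \<open>f * L a * L b\<close> differ by the syzygy with
    cofactors \<open>D a b j\<close>.\<close>
  define D where "D = (\<lambda>a b j. L a * M b j - L b * M a j)"
  have D_forms: "D a b j \<in> forms 2" for a b j
    using forms_mult[OF L_forms M_forms] unfolding D_def by (intro forms_diff) (auto simp: numeral_2_eq_2)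
  have D_syz: "(\<Sum>j=1..r. F j * D a b j) = 0" if a: "a \<in> {1..r}" and b: "b \<in> {1..r}" for a b
  proof -
    have "(\<Sum>j=1..r. F j * D a b j) = L a * (\<Sum>j=1..r. F j * M b j) - L b * (\<Sum>j=1..r. F j * M a j)"
      by (simp add: D_def sum_distrib_left sum_subtractf algebra_simps)
    also have "\<dots> = 0" unfolding fM[OF a, symmetric] fM[OF b, symmetric] by (simp add: algebra_simps)
    finally show ?thesis .
  qed
  have D_van: "vanishes (D a b j)" if a: "a \<in> {1..r}" and b: "b \<in> {1..r}" and j: "j \<in> {1..r}" for a b j
  proof (rule syzygy_vanishes[OF _ j])
    fix x :: "complex ^ 'n"
    show "(\<Sum>j=1..r. ev (F j) x * ev (D a b j) x) = 0"
      using arg_cong[OF D_syz[OF a b], of "\<lambda>p. ev p x"] by simp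
  qed
  have gradD: "grad (D a b j) p = (if j = b then 1 else 0) *s grad (F a) p - (if j = a then 1 else 0) *s grad (F b) p"
    if a: "a \<in> {1..r}" and b: "b \<in> {1..r}" and j: "j \<in> {1..r}" for a b j
  proof -
    have "grad (D a b j + L b * M a j) p = grad (L a * M b j) p" by (simp add: D_def)
    then show ?thesis using Lp[OF a] Lp[OF b] Mp[OF a j] Mp[OF b j]
      by (simp add: grad_add grad_mult gradL algebra_simps)
  qed
  have nz: "grad (F 2) p \<noteq> 0" using grad_F_nonzero[OF p] s_facts by simp
  consider "2 < d" | "r = 3" "d = 2" using params by auto
  then show False
  proof cases
    case 1
    \<comment> \<open>The cofactor has degree 2, below \<open>d\<close>, so it is zero, but its
      gradient at \<open>p\<close> is minus that of \<open>F 2\<close>.\<close>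
    have "ev (D 1 2 1) x = 0" for x :: "complex ^ 'n"
      using vanishing_low_degree[OF D_forms D_van 1] s_facts by simp
    then have "grad (D 1 2 1) p = grad 0 p" by (intro grad_cong) simp
    then show False using gradD[of 1 2 1] nz grad_const[of 0 p] s_facts by simp
  next
    case 2
    \<comment> \<open>In degree \<open>d\<close> a vanishing form is a combination of the
      \<open>F j\<close>, and its gradient at \<open>p\<close> determines the combination.\<close>
    have D_eq: "D a b j = scale (if j = b then 1 else 0) (F a) - scale (if j = a then 1 else 0) (F b)"
      if a: "a \<in> {1..r}" and b: "b \<in> {1..r}" and j: "j \<in> {1..r}" for a b j
    proof -
      define E where "E = D a b j - (scale (if j = b then 1 else 0) (F a) - scale (if j = a then 1 else 0) (F b))"
      have "E \<in> forms d" unfolding E_def using D_forms 2 F_forms a b by (intro forms_diff forms_scale) auto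
      moreover have "vanishes E" using D_van[OF a b j] F_pts a b by (auto simp: E_def vanishes_def)
      ultimately obtain c where c: "E = (\<Sum>j=1..r. scale (c j) (F j))" using vanishing_degree_d by blast
      have "grad (E + scale (if j = b then 1 else 0) (F a)) p
        = grad (D a b j + scale (if j = a then 1 else 0) (F b)) p"
        by (simp add: E_def algebra_simps)
      then have "grad E p = 0" using gradD[OF a b j] by (simp add: grad_add grad_scale split: if_splits)
      then have "c j = 0" if "j \<in> {1..r}" for j using grad_combination_zero[OF c[symmetric] p] that by blast
      then have "E = 0" using c by simp
      then show ?thesis by (simp add: E_def)
    qed
    \<comment> \<open>The cyclic sum cancels by the definition of \<open>D\<close>; substituting
      \<open>D_eq\<close> leaves a linear syzygy between \<open>F 2\<close> and \<open>F 3\<close>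
      alone, which forces \<open>L 2\<close> to vanish.\<close>
    have "L 3 * D 1 2 1 + L 1 * D 2 3 1 + L 2 * D 3 1 1 = 0" by (simp add: D_def algebra_simps)
    then have eq: "L 2 * F 3 - L 3 * F 2 = 0" using 2 by (simp add: D_eq algebra_simps)
    define g where "g = (\<lambda>j :: nat. if j = 2 then - L 3 else if j = 3 then L 2 else (0 :: 'n rpoly))"
    have "vanishes (g 3)"
    proof (rule syzygy_vanishes)
      fix x :: "complex ^ 'n"
      have "{1..r} = {1, 2, 3}" using 2 by auto
      then have "(\<Sum>j=1..r. ev (F j) x * ev (g j) x) = ev (L 2 * F 3 - L 3 * F 2) x"
        by (simp add: g_def algebra_simps)
      then show "(\<Sum>j=1..r. ev (F j) x * ev (g j) x) = 0" using eq by simp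
    qed (use 2 in simp)
    then have "ev (L 2) x = 0" for x :: "complex ^ 'n"
      using vanishing_low_degree[OF L_forms, of 2] s_facts by (simp add: g_def)
    then have "grad (L 2) p = grad 0 p" by (intro grad_cong) simp
    then show False using gradL nz grad_const[of 0 p] by simp
  qed
qed

end

subsection \<open>Positive functionals and extreme rays\<close>

lemma form_dual_functional_on: "l \<in> form_dual k \<Longrightarrow> rp.functional_on (forms k) l"
  by (simp add: form_dual_def rp.functional_on_def)

lemma form_dual_zero: "l \<in> form_dual k \<Longrightarrow> l 0 = 0"
  using rp.subspace_0[OF subspace_forms, of k] by (fastforce simp: form_dual_def)

lemma square_forms: "f \<in> forms d \<Longrightarrow> f ^ 2 \<in> forms (2 * d)"
  by (rule forms_power)

lemma sos_dualI:
  assumes l: "l \<in> form_dual (2 * d)" and sq: "\<And>f. f \<in> forms d \<Longrightarrow> 0 \<le> l (f ^ 2)"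
  shows "l \<in> sos_dual d"
proof -
  have add: "l (p + q) = l p + l q" if "p \<in> forms (2 * d)" "q \<in> forms (2 * d)" for p q
    using l that by (simp add: form_dual_def)
  have l0: "l 0 = 0" using l by (rule form_dual_zero)
  have "0 \<le> l (\<Sum>q\<leftarrow>qs. q ^ 2) \<and> (\<Sum>q\<leftarrow>qs. q ^ 2) \<in> forms (2 * d)" if "set qs \<subseteq> forms d" for qs
    using that
  proof (induction qs)
    case Nil
    then show ?case using l0 rp.subspace_0[OF subspace_forms] by simp
  next
    case (Cons q qs)
    then show ?case using sq[of q] square_forms[of q d] by (auto simp: add forms_add)
  qed
  then show ?thesis using l by (auto simp: sos_dual_def sos_cone_def)
qed

lemma sos_dualD:
  assumes "l \<in> sos_dual d" "f \<in> forms d"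
  shows "0 \<le> l (f ^ 2)"
proof -
  have "f ^ 2 \<in> sos_cone d"
    using assms(2) square_forms[OF assms(2)] by (auto simp: sos_cone_def intro!: exI[of _ "[f]"])
  then show ?thesis using assms(1) by (simp add: sos_dual_def)
qed

text \<open>As \<open>l (f ^ 2) = 0\<close>, positivity on the square of
  \<open>scale x f + g\<close> bounds an affine function of \<open>x\<close> from below, so its
  slope is 0.\<close>

lemma sos_dual_radical:
  assumes l: "l \<in> sos_dual d" and f: "f \<in> forms d" "l (f ^ 2) = 0" and g: "g \<in> forms d"
  shows "l (f * g) = 0"
proof -
  have lin: "rp.functional_on (forms (2 * d)) l"
    using l by (simp add: sos_dual_def form_dual_functional_on)
  have fg: "f * g \<in> forms (2 * d)" using forms_mult[OF f(1) g] by (simp add: mult_2)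
  have *: "0 \<le> 2 * x * l (f * g) + l (g ^ 2)" for x
  proof -
    have "scale (2 * x) (f * g) = scale x (f * g) + scale x (f * g)"
      unfolding mult_2 by (rule rp.scale_left_distrib)
    then have "(scale x f + g) ^ 2 = scale (x ^ 2) (f ^ 2) + (scale (2 * x) (f * g) + g ^ 2)"
      by (simp only: power2_eq_square distrib_left distrib_right scale_mult_left scale_mult_right
          rp.scale_scale rp.scale_right_distrib add_ac mult.commute[of g f])
    moreover have "l (scale (x ^ 2) (f ^ 2) + (scale (2 * x) (f * g) + g ^ 2)) =
        x ^ 2 * l (f ^ 2) + (2 * x * l (f * g) + l (g ^ 2))"
      using lin square_forms[OF f(1)] square_forms[OF g] fg
      by (simp add: rp.functional_on_def forms_scale forms_add)
    ultimately show ?thesis using sos_dualD[OF l forms_add[OF forms_scale[OF f(1), of x] g]] f by simp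
  qed
  show ?thesis
  proof (rule ccontr)
    assume "l (f * g) \<noteq> 0"
    \<comment> \<open>This \<open>x\<close> makes the affine function equal to -1.\<close>
    then show False using *[of "- (l (g ^ 2) + 1) / (2 * l (f * g))"] by (simp add: field_simps)
  qed
qed

section \<open>Diagonal functionals and their positivity\<close>

context cb_configuration
begin

definition pair_functional :: "(nat \<Rightarrow> real) \<Rightarrow> real \<Rightarrow> real \<Rightarrow> 'n rpoly \<Rightarrow> real" where
  "pair_functional a m t p =
     (if p \<in> forms (2 * d) then (\<Sum>i=1..s - 2. a i * ev p (v i)) + 2 * Re (Complex m t * ev p z) else 0)"

text \<open>The diagonal form on an arbitrary vector of values, with \<open>w\<close> the value at
  \<open>z\<close>; \<open>interpolation\<close> says which vectors come from forms, so positivity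
  can be studied on the hyperplane.\<close>

definition qval :: "(nat \<Rightarrow> real) \<Rightarrow> real \<Rightarrow> real \<Rightarrow> (nat \<Rightarrow> real) \<Rightarrow> complex \<Rightarrow> real" where
  "qval a m t x w = (\<Sum>i=1..s - 2. a i * (x i)\<^sup>2) + 2 * Re (Complex m t * w\<^sup>2)"

lemma pair_form_qval: "pair_form (s - 2) v z a m t f = qval a m t (\<lambda>i. ev f (v i)) (ev f z)"
  by (simp add: pair_form_def qval_def power2_eq_square algebra_simps)

lemma pair_functional_square:
  "f \<in> forms d \<Longrightarrow> pair_functional a m t (f ^ 2) = qval a m t (\<lambda>i. ev f (v i)) (ev f z)"
  by (simp add: pair_functional_def square_forms qval_def)

lemma pair_functional_form_dual: "pair_functional a m t \<in> form_dual (2 * d)"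
  by (auto simp: form_dual_def pair_functional_def forms_add forms_scale algebra_simps
      sum.distrib sum_distrib_left)

text \<open>Each \<open>F j\<close> lies in the kernel, so \<open>l\<close> kills the products
  \<open>F j * g j\<close>. By \<open>max_noether\<close> it kills every form that vanishes at the
  points and is therefore a combination of the \<open>phi k\<close>.\<close>

lemma pair_functional_representation:
  assumes l: "l \<in> form_dual (2 * d)" and F: "\<And>j. j \<in> {1..r} \<Longrightarrow> F j \<in> Qker d l"
  obtains a m t where "l = pair_functional a m t"
proof -
  have lin: "rp.functional_on (forms (2 * d)) l" using l by (rule form_dual_functional_on)
  have l0: "l 0 = 0" using l by (rule form_dual_zero)
  have "\<exists>c. \<forall>p\<in>forms (2 * d). l p = (\<Sum>k\<in>{1..s}. c k * phi k p)"
  proof (rule rp.functional_span[OF _ subspace_forms functional_phi lin])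
    fix p assume p: "p \<in> forms (2 * d)" "\<forall>i\<in>{1..s}. phi i p = 0"
    then have "vanishes p" by (simp add: vanishes_iff)
    then obtain g where g: "\<And>j. j \<in> {1..r} \<Longrightarrow> g j \<in> forms d" "p = (\<Sum>j=1..r. F j * g j)"
      using max_noether[OF p(1)] by metis
    have Fg: "F j * g j \<in> forms (2 * d) \<and> l (F j * g j) = 0" if "j \<in> {1..r}" for j
      using F[OF that] g(1)[OF that] forms_mult[OF F_forms[OF that] g(1)[OF that]]
      by (simp add: Qker_def mult_2)
    have "finite J \<Longrightarrow> J \<subseteq> {1..r} \<Longrightarrow> l (\<Sum>j\<in>J. F j * g j) = 0" for J
    proof (induction J rule: finite_induct)
      case (insert j J)
      then have "F j * g j \<in> forms (2 * d)" "(\<Sum>j\<in>J. F j * g j) \<in> forms (2 * d)"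
        using Fg by (auto intro!: forms_sum)
      then show ?case using insert Fg lin by (auto simp: rp.functional_on_def)
    qed (simp add: l0)
    then show "l p = 0" using g(2) by blast
  qed simp
  then obtain c where c: "\<And>p. p \<in> forms (2 * d) \<Longrightarrow> l p = (\<Sum>k\<in>{1..s}. c k * phi k p)" by blast
  \<comment> \<open>\<open>2 * Re (Complex m t * w)\<close> is
    \<open>2 * m * Re w - 2 * t * Im w\<close>, whence the halves and the sign.\<close>
  have "l p = pair_functional c (c (s - 1) / 2) (- c s / 2) p" for p
  proof (cases "p \<in> forms (2 * d)")
    case True
    then show ?thesis unfolding c[OF True] sum_phi by (simp add: pair_functional_def)
  next
    case False
    then show ?thesis using l by (simp add: form_dual_def pair_functional_def)
  qed
  then show ?thesis using that by blast
qed

lemma real_point_nonzero: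
  assumes "i \<in> {1..s - 2}"
  obtains p where "p \<in> forms (2 * d)" "ev p (v i) \<noteq> 0"
proof -
  have "linear_form (v i) ^ (2 * d) \<in> forms ((2 * d) * 1)"
    by (intro forms_power linear_form_forms)
  moreover have "ev (linear_form (v i)) (v i) = v i \<bullet> v i" by (simp add: ev_linear_form inner_vec_def)
  ultimately show ?thesis using v_nonzero[OF assms] by (intro that[of "linear_form (v i) ^ (2 * d)"]) auto
qed

text \<open>Otherwise \<open>c\<close> times the evaluation at \<open>v i\<close> could be split off
  from \<open>l\<close>. Extremality would make it a multiple of \<open>l\<close>, nonzero since
  some form is nonzero at \<open>v i\<close>, and \<open>l\<close> would be a point
  evaluation.\<close>

lemma extreme_no_point_part:
  assumes l: "spans_extreme_ray d l" "\<not> is_point_evaluation d l"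
    and i: "i \<in> {1..s - 2}" and c: "0 < c"
  shows "\<exists>f\<in>forms d. l (f ^ 2) < c * (ev f (v i))\<^sup>2"
proof (rule ccontr)
  assume "\<not> ?thesis"
  then have ge: "c * (ev f (v i))\<^sup>2 \<le> l (f ^ 2)" if "f \<in> forms d" for f using that by force
  have ld: "l \<in> form_dual (2 * d)" using l by (simp add: spans_extreme_ray_def sos_dual_def)
  define l1 where "l1 = (\<lambda>p. if p \<in> forms (2 * d) then c * ev p (v i) else 0)"
  define l2 where "l2 = (\<lambda>p. l p - l1 p)"
  have l1d: "l1 \<in> form_dual (2 * d)"
    by (auto simp: form_dual_def l1_def forms_add forms_scale algebra_simps)
  have "l1 \<in> sos_dual d" using c by (intro sos_dualI l1d) (simp add: l1_def square_forms)
  moreover have "l2 \<in> sos_dual d"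
  proof (rule sos_dualI)
    show "l2 \<in> form_dual (2 * d)" using l1d ld by (auto simp: form_dual_def l2_def algebra_simps)
    show "0 \<le> l2 (f ^ 2)" if "f \<in> forms d" for f
      using ge[OF that] that by (simp add: l2_def l1_def square_forms)
  qed
  moreover have "l = (\<lambda>p. l1 p + l2 p)" by (simp add: l2_def)
  ultimately obtain k where k: "l1 = (\<lambda>p. k * l p)" using l(1) unfolding spans_extreme_ray_def by blast
  obtain p where p: "p \<in> forms (2 * d)" "ev p (v i) \<noteq> 0" using real_point_nonzero[OF i] by blast
  have "k \<noteq> 0" using fun_cong[OF k, of p] p c by (auto simp: l1_def)
  then have "l p = (c / k) * ev p (v i)" if "p \<in> forms (2 * d)" for p
    using fun_cong[OF k, of p] that by (simp add: l1_def field_simps)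
  then show False using l(2) unfolding is_point_evaluation_def by blast
qed

lemma qval_point: "i \<in> {1..s - 2} \<Longrightarrow> qval a m t (\<lambda>k. if k = i then x else 0) w = a i * x\<^sup>2 + 2 * Re (Complex m t * w\<^sup>2)"
  by (simp add: qval_def if_distrib[of "\<lambda>x. x ^ 2"] if_distrib[of "\<lambda>x. _ * x"] cong: if_cong)

lemma sum_point: "i \<in> {1..s - 2} \<Longrightarrow> (\<Sum>k=1..s - 2. u k * (if k = i then x else 0)) = u i * x"
  by (simp add: if_distrib[of "\<lambda>x. _ * x"] cong: if_cong)

text \<open>Weighted Cauchy-Schwarz bounds the square of \<open>2 * Re w\<close> by
  \<open>S * A\<close>, and the inequality on the parameters bounds \<open>S\<close> by
  \<open>- 2 * m / N\<close>. As the \<open>u i\<close> are nonzero, \<open>S > 0\<close> and so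
  \<open>m < 0\<close>; completing a square in \<open>w\<close> then gives the claim.\<close>

lemma qval_nonneg:
  assumes a: "\<And>i. i \<in> {1..s - 2} \<Longrightarrow> 0 < a i" and mt: "\<not> (m = 0 \<and> t = 0)"
    and le: "2 * m / (m\<^sup>2 + t\<^sup>2) + (\<Sum>i=1..s - 2. (u i)\<^sup>2 / a i) \<le> 0"
    and xw: "(\<Sum>i=1..s - 2. u i * x i) + 2 * Re w = 0"
  shows "0 \<le> qval a m t x w"
proof -
  define S where "S = (\<Sum>i=1..s - 2. (u i)\<^sup>2 / a i)"
  define A where "A = (\<Sum>i=1..s - 2. a i * (x i)\<^sup>2)"
  define N where "N = m\<^sup>2 + t\<^sup>2"
  have a': "0 \<le> a i" "a i \<noteq> 0" if "i \<in> {1..s - 2}" for i using a[OF that] by auto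
  have N: "N > 0" using mt by (auto simp: N_def sum_power2_gt_zero_iff)
  have "S > 0" unfolding S_def
    using a u_nonzero s_facts by (intro sum_pos) auto
  then have "2 * m / N < 0" using le by (simp add: S_def N_def)
  then have m: "m < 0" using N by (simp add: divide_less_0_iff)
  have A: "0 \<le> A" unfolding A_def using a by (intro sum_nonneg mult_nonneg_nonneg) (auto intro: less_imp_le)
  have "(2 * Re w)\<^sup>2 = (\<Sum>i=1..s - 2. u i * x i)\<^sup>2" using xw by (simp add: add_eq_0_iff power2_commute)
  also have "(\<Sum>i=1..s - 2. u i * x i) = (\<Sum>i=1..s - 2. (u i / sqrt (a i)) * (sqrt (a i) * x i))"
    using a' by (intro sum.cong) auto
  also have "\<dots>\<^sup>2 \<le> (\<Sum>i=1..s - 2. (u i / sqrt (a i))\<^sup>2) * (\<Sum>i=1..s - 2. (sqrt (a i) * x i)\<^sup>2)"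
    by (rule Cauchy_Schwarz_ineq_sum)
  also have "(\<Sum>i=1..s - 2. (u i / sqrt (a i))\<^sup>2) = S"
    unfolding S_def using a' by (intro sum.cong) (auto simp: power_divide)
  also have "(\<Sum>i=1..s - 2. (sqrt (a i) * x i)\<^sup>2) = A"
    unfolding A_def using a' by (intro sum.cong) (auto simp: power_mult_distrib)
  also have "S * A \<le> (- 2 * m / N) * A"
    using le A by (intro mult_right_mono) (auto simp: S_def N_def)
  finally have "4 * (Re w)\<^sup>2 * N \<le> - 2 * m * A" using N by (simp add: field_simps)
  then have *: "2 * (Re w)\<^sup>2 * (m\<^sup>2 + t\<^sup>2) \<le> (- m) * A" by (simp add: N_def mult.assoc mult.commute)
  have q: "qval a m t x w = A + 2 * m * ((Re w)\<^sup>2 - (Im w)\<^sup>2) - 4 * t * Re w * Im w"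
    by (simp add: qval_def A_def power2_eq_square algebra_simps)
  \<comment> \<open>\<open>- m\<close> times the form dominates this square.\<close>
  have "0 \<le> 2 * (t * Re w + m * Im w)\<^sup>2" by simp
  also have "\<dots> = 2 * (Re w)\<^sup>2 * (m\<^sup>2 + t\<^sup>2) - 2 * m\<^sup>2 * ((Re w)\<^sup>2 - (Im w)\<^sup>2) + 4 * m * t * Re w * Im w"
    by (simp add: power2_eq_square algebra_simps)
  also have "\<dots> \<le> (- m) * qval a m t x w"
    using * unfolding q by (simp add: power2_eq_square algebra_simps)
  finally show ?thesis using m by (simp add: mult_le_0_iff)
qed

lemma Re_inverse_Complex: "Re (inverse (Complex m t)) = m / (m\<^sup>2 + t\<^sup>2)"
  by simp

lemma pair_functional_sos_dual:
  assumes "admissible (s - 2) u a m t"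
  shows "pair_functional a m t \<in> sos_dual d"
proof (rule sos_dualI[OF pair_functional_form_dual])
  fix f :: "'n rpoly" assume f: "f \<in> forms d"
  have "0 \<le> qval a m t (\<lambda>i. ev f (v i)) (ev f z)"
    using assms real_relation[OF f] by (intro qval_nonneg) (auto simp: admissible_def)
  then show "0 \<le> pair_functional a m t (f ^ 2)" using f by (simp add: pair_functional_square)
qed

text \<open>A summand \<open>l1\<close> inherits the null vectors of the form: the
  \<open>F j\<close>, so that it is again diagonal, and the null form \<open>f\<close>.
  Orthogonality to \<open>f\<close> is a relation among evaluations, whose uniqueness makes
  \<open>l1\<close> proportional to the whole.\<close>

lemma pair_functional_extreme:
  assumes adm: "admissible (s - 2) u a m t"
  shows "spans_extreme_ray d (pair_functional a m t)"
proof -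
  let ?l = "pair_functional a m t"
  define \<mu> where "\<mu> = Complex m t"
  have a: "\<And>i. i \<in> {1..s - 2} \<Longrightarrow> 0 < a i" and mt: "\<not> (m = 0 \<and> t = 0)"
    and eq: "2 * m / (m\<^sup>2 + t\<^sup>2) + (\<Sum>i=1..s - 2. (u i)\<^sup>2 / a i) = 0"
    using adm by (auto simp: admissible_def)
  have anz: "a i \<noteq> 0" if "i \<in> {1..s - 2}" for i using a[OF that] by simp
  have \<mu>: "\<mu> \<noteq> 0" using mt by (auto simp: \<mu>_def complex_eq_iff)
  have l: "?l \<in> sos_dual d" using adm by (rule pair_functional_sos_dual)
  \<comment> \<open>The values \<open>u 2\<close> and \<open>- u 1\<close> at the first two points
    lie on the hyperplane. The form is positive at the resulting \<open>f0\<close>, which fixes the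
    sign of \<open>\<kappa>\<close>.\<close>
  define x0 where "x0 = (\<lambda>k :: nat. (if k = 1 then u 2 else 0) + (if k = 2 then - u 1 else 0))"
  have "(\<Sum>k=1..s - 2. u k * x0 k) = u 1 * u 2 + u 2 * (- u 1)"
    unfolding x0_def distrib_left sum.distrib sum_point[OF s_facts(3)] sum_point[OF s_facts(4)] by simp
  then have "(\<Sum>k=1..s - 2. u k * x0 k) + 2 * Re 0 = 0" by simp
  then obtain f0 where f0: "f0 \<in> forms d" "\<And>i. i \<in> {1..s - 2} \<Longrightarrow> ev f0 (v i) = x0 i" "ev f0 z = 0"
    by (rule interpolation) blast
  have "0 < (\<Sum>i=1..s - 2. a i * (ev f0 (v i))\<^sup>2)"
  proof (rule sum_pos2[where i = 1])
    show "0 < a 1 * (ev f0 (v 1))\<^sup>2"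
      using a[OF s_facts(3)] f0(2)[OF s_facts(3)] u_nonzero[OF s_facts(4)] by (simp add: x0_def)
    show "0 \<le> a i * (ev f0 (v i))\<^sup>2" if "i \<in> {1..s - 2}" for i
      using a[OF that] by simp
  qed (use s_facts in auto)
  then have pos: "0 < ?l (f0 ^ 2)" using f0 by (simp add: pair_functional_square qval_def)
  have "(\<Sum>i=1..s - 2. u i * (u i / a i)) + 2 * Re (inverse \<mu>) = 0"
    using eq unfolding \<mu>_def Re_inverse_Complex by (simp add: power2_eq_square)
  then obtain f where f: "f \<in> forms d" "\<And>i. i \<in> {1..s - 2} \<Longrightarrow> ev f (v i) = u i / a i" "ev f z = inverse \<mu>"
    by (rule interpolation) blast
  have f_null: "?l (f ^ 2) = 0"
  proof -
    have "(\<Sum>i=1..s - 2. a i * (ev f (v i))\<^sup>2) = (\<Sum>i=1..s - 2. (u i)\<^sup>2 / a i)"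
      using anz by (intro sum.cong) (auto simp: f(2) power2_eq_square)
    moreover have "\<mu> * (ev f z)\<^sup>2 = inverse \<mu>" using \<mu> f(3) by (simp add: power2_eq_square)
    ultimately have "qval a m t (\<lambda>i. ev f (v i)) (ev f z) = (\<Sum>i=1..s - 2. (u i)\<^sup>2 / a i) + 2 * Re (inverse \<mu>)"
      unfolding qval_def \<mu>_def[symmetric] by simp
    also have "\<dots> = 0" using eq unfolding \<mu>_def Re_inverse_Complex by simp
    finally show ?thesis using f(1) by (simp add: pair_functional_square)
  qed
  have "\<exists>c\<ge>0. l1 = (\<lambda>p. c * ?l p)"
    if l1: "l1 \<in> sos_dual d" and l2: "l2 \<in> sos_dual d" and sum: "?l = (\<lambda>p. l1 p + l2 p)" for l1 l2
  proof -
    have null: "l1 (g ^ 2) = 0" if g: "g \<in> forms d" "?l (g ^ 2) = 0" for g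
    proof -
      have "l1 (g ^ 2) + l2 (g ^ 2) = 0" using fun_cong[OF sum, of "g ^ 2"] g by simp
      then show ?thesis using sos_dualD[OF l1 g(1)] sos_dualD[OF l2 g(1)] by linarith
    qed
    have "F j \<in> Qker d l1" if j: "j \<in> {1..r}" for j
    proof -
      have "ev (F j) (v i) = 0" if "i \<in> {1..s - 2}" for i
        using vanishes_F[OF j] that by (auto simp: vanishes_def pts_def ev_cvec)
      then have "?l (F j ^ 2) = 0"
        using F_forms[OF j] F_pts[OF j pts_mem(2)] by (simp add: pair_functional_square qval_def)
      then have "l1 (F j ^ 2) = 0" using null F_forms[OF j] by blast
      then show ?thesis using sos_dual_radical[OF l1 F_forms[OF j]] F_forms[OF j] by (simp add: Qker_def)
    qed
    moreover have "l1 \<in> form_dual (2 * d)" using l1 by (simp add: sos_dual_def)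
    ultimately obtain b m1 t1 where rep: "l1 = pair_functional b m1 t1"
      using pair_functional_representation by metis
    \<comment> \<open>Pairing with \<open>f\<close> weights \<open>l1\<close> by
      \<open>u i / a i\<close> and \<open>inverse \<mu>\<close>; \<open>c\<close> lists the
      resulting real coefficients.\<close>
    define \<nu> where "\<nu> = Complex m1 t1 / \<mu>"
    define c where "c = (\<lambda>i. if i = s then - 2 * Im \<nu> else if i = s - 1 then 2 * Re \<nu> else b i * (u i / a i))"
    have c: "c i = b i * (u i / a i)" if "i \<in> {1..s - 2}" for i using that s_eq by (auto simp: c_def)
    have cs: "c (s - 1) = 2 * Re \<nu>" "c s = - 2 * Im \<nu>" using s_eq by (auto simp: c_def)
    have "(\<Sum>k=1..s. c k * phi k g) = 0" if g: "g \<in> forms d" for g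
    proof -
      have "(\<Sum>k=1..s. c k * phi k g) = (\<Sum>i=1..s - 2. b i * (u i / a i) * ev g (v i)) + 2 * Re (\<nu> * ev g z)"
        unfolding sum_phi cs using c by (simp add: algebra_simps)
      also have "\<dots> = (\<Sum>i=1..s - 2. b i * ev (f * g) (v i)) + 2 * Re (Complex m1 t1 * ev (f * g) z)"
        using f by (simp add: \<nu>_def field_simps)
      also have "\<dots> = l1 (f * g)"
        using forms_mult[OF f(1) g] unfolding mult_2[symmetric] by (simp only: rep pair_functional_def if_True)
      also have "\<dots> = 0" using sos_dual_radical[OF l1 f(1) null[OF f(1) f_null] g] .
      finally show ?thesis .
    qed
    then obtain \<kappa> where \<kappa>: "\<forall>i\<in>{1..s - 2}. c i = \<kappa> * u i" "c (s - 1) = 2 * \<kappa>" "c s = 0"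
      using phi_relation by blast
    have b: "b i = \<kappa> * a i" if i: "i \<in> {1..s - 2}" for i
    proof -
      have "b i * (u i / a i) = \<kappa> * u i" using \<kappa>(1) c i by metis
      then show ?thesis using u_nonzero[OF i] a[OF i] by (simp add: field_simps)
    qed
    have "\<nu> = of_real \<kappa>" using \<kappa> cs by (simp add: complex_eq_iff)
    then have \<mu>1: "Complex m1 t1 = of_real \<kappa> * \<mu>" using \<mu> by (simp add: \<nu>_def field_simps)
    have eq: "l1 = (\<lambda>p. \<kappa> * ?l p)"
    proof
      fix p
      have "(\<Sum>i=1..s - 2. b i * ev p (v i)) = \<kappa> * (\<Sum>i=1..s - 2. a i * ev p (v i))"
        unfolding sum_distrib_left using b by (intro sum.cong) auto
      then show "l1 p = \<kappa> * ?l p"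
        unfolding rep pair_functional_def \<mu>1 \<mu>_def[symmetric] by (simp add: algebra_simps)
    qed
    have "0 \<le> \<kappa> * ?l (f0 ^ 2)" using sos_dualD[OF l1 f0(1)] eq by metis
    then have "\<kappa> \<ge> 0" using pos by (simp add: zero_le_mult_iff)
    then show ?thesis using eq by blast
  qed
  moreover have "?l \<noteq> (\<lambda>p. 0)" using pos by force
  ultimately show ?thesis using l unfolding spans_extreme_ray_def by blast
qed

text \<open>Test vectors on the hyperplane recover the parameters: \<open>w = \<i>\<close> alone
  gives \<open>m\<close>; the unit vector at \<open>v i\<close> with
  \<open>w = - u i / 2 + \<i> * y\<close> gives \<open>t\<close> by comparing \<open>y = 0\<close>
  and \<open>y = 1\<close>, as \<open>u i\<close> is nonzero, and then \<open>a i\<close>.\<close>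

lemma pair_form_unique:
  assumes eq: "\<And>f. f \<in> forms d \<Longrightarrow> pair_form (s - 2) v z a m t f = pair_form (s - 2) v z a' m' t' f"
  shows "m = m' \<and> t = t' \<and> (\<forall>i\<in>{1..s - 2}. a i = a' i)"
proof -
  have q: "qval a m t x w = qval a' m' t' x w" if "(\<Sum>i=1..s - 2. u i * x i) + 2 * Re w = 0" for x w
  proof -
    obtain f where f: "f \<in> forms d" "\<And>i. i \<in> {1..s - 2} \<Longrightarrow> ev f (v i) = x i" "ev f z = w"
      using interpolation[OF \<open>(\<Sum>i=1..s - 2. u i * x i) + 2 * Re w = 0\<close>] by blast
    have "qval a m t (\<lambda>i. ev f (v i)) (ev f z) = qval a' m' t' (\<lambda>i. ev f (v i)) (ev f z)"
      using eq[OF f(1)] by (simp add: pair_form_qval)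
    then show ?thesis using f by (simp add: qval_def)
  qed
  have m: "m = m'" using q[of "\<lambda>i. 0" \<i>] by (simp add: qval_def)
  have pt: "a i + 2 * Re (Complex m t * (Complex (- u i / 2) y)\<^sup>2) = a' i + 2 * Re (Complex m' t' * (Complex (- u i / 2) y)\<^sup>2)"
    if i: "i \<in> {1..s - 2}" for i y
    using q[of "\<lambda>k. if k = i then 1 else 0" "Complex (- u i / 2) y"] sum_point[OF i, of 1] qval_point[OF i]
    by simp
  have "t = t'"
    using pt[OF s_facts(3), of 0] pt[OF s_facts(3), of 1] m u_nonzero[OF s_facts(3)]
    by (simp add: power2_eq_square algebra_simps)
  moreover have "a i = a' i" if "i \<in> {1..s - 2}" for i
    using pt[OF that, of 0] m by (simp add: power2_eq_square)
  ultimately show ?thesis using m by blast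
qed

text \<open>Positivity gives \<open>a i > 0\<close> and excludes \<open>\<Phi> > 0\<close>;
  extremality excludes \<open>m = t = 0\<close> and \<open>\<Phi> < 0\<close>, where a point
  evaluation could be split off.\<close>

lemma extreme_admissible:
  assumes l: "spans_extreme_ray d l" "\<not> is_point_evaluation d l" and rep: "l = pair_functional a m t"
  shows "admissible (s - 2) u a m t"
proof -
  have sos: "l \<in> sos_dual d" and nz: "l \<noteq> (\<lambda>p. 0)" using l(1) by (auto simp: spans_extreme_ray_def)
  have q: "0 \<le> qval a m t x w" if "(\<Sum>i=1..s - 2. u i * x i) + 2 * Re w = 0" for x w
  proof -
    obtain f where f: "f \<in> forms d" "\<And>i. i \<in> {1..s - 2} \<Longrightarrow> ev f (v i) = x i" "ev f z = w"
      using interpolation[OF \<open>(\<Sum>i=1..s - 2. u i * x i) + 2 * Re w = 0\<close>] by blast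
    have "0 \<le> qval a m t (\<lambda>i. ev f (v i)) (ev f z)"
      using sos_dualD[OF sos f(1)] f(1) by (simp add: rep pair_functional_square)
    then show ?thesis using f by (simp add: qval_def)
  qed
  have mt: "\<not> (m = 0 \<and> t = 0)"
  proof
    assume mt: "m = 0 \<and> t = 0"
    then have 0: "Complex m t = 0" by (simp add: complex_eq_iff)
    have a: "0 \<le> a i" if i: "i \<in> {1..s - 2}" for i
      using q[of "\<lambda>k. if k = i then 1 else 0" "of_real (- u i / 2)"] sum_point[OF i, of 1] qval_point[OF i, of a m t 1]
      by (simp add: 0)
    have "\<exists>i\<in>{1..s - 2}. a i \<noteq> 0"
    proof (rule ccontr)
      assume "\<not> ?thesis"
      then have "l p = 0" for p by (simp add: rep pair_functional_def 0)
      then show False using nz by blast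
    qed
    then obtain i where i: "i \<in> {1..s - 2}" "0 < a i" using a by force
    then obtain f where f: "f \<in> forms d" "l (f ^ 2) < a i * (ev f (v i))\<^sup>2"
      using extreme_no_point_part[OF l] by blast
    have "a i * (ev f (v i))\<^sup>2 \<le> (\<Sum>i=1..s - 2. a i * (ev f (v i))\<^sup>2)"
      using i a by (intro member_le_sum) auto
    then show False using f by (simp add: rep pair_functional_square qval_def 0)
  qed
  define \<mu> where "\<mu> = Complex m t"
  have \<mu>: "\<mu> \<noteq> 0" using mt by (auto simp: \<mu>_def complex_eq_iff)
  \<comment> \<open>A value at \<open>z\<close> for which the conjugate pair contributes -2.\<close>
  define w0 where "w0 = csqrt (- inverse \<mu>)"
  have w0: "\<mu> * w0\<^sup>2 = - 1" using \<mu> by (simp add: w0_def)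
  have a: "0 < a i" if i: "i \<in> {1..s - 2}" for i
  proof (rule ccontr)
    assume neg: "\<not> 0 < a i"
    define x where "x = - 2 * Re w0 / u i"
    have "u i * x + 2 * Re w0 = 0" using u_nonzero[OF i] by (simp add: x_def)
    then have "0 \<le> a i * x\<^sup>2 - 2"
      using q[of "\<lambda>k. if k = i then x else 0" w0] sum_point[OF i, of x] qval_point[OF i, of a m t x w0] w0
      by (simp add: \<mu>_def[symmetric])
    moreover have "a i * x\<^sup>2 \<le> 0" using neg by (intro mult_nonpos_nonneg) auto
    ultimately show False by simp
  qed
  have anz: "a i \<noteq> 0" if "i \<in> {1..s - 2}" for i using a[OF that] by simp
  define \<Phi> where "\<Phi> = 2 * m / (m\<^sup>2 + t\<^sup>2) + (\<Sum>i=1..s - 2. (u i)\<^sup>2 / a i)"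
  have Re\<mu>: "2 * Re (inverse \<mu>) + (\<Sum>i=1..s - 2. (u i)\<^sup>2 / a i) = \<Phi>"
    unfolding \<mu>_def Re_inverse_Complex \<Phi>_def by simp
  have "\<not> 0 < \<Phi>"
  proof
    assume pos: "0 < \<Phi>"
    \<comment> \<open>Subtracting \<open>c\<close> times the vector with entries
      \<open>u i / a i\<close> and \<open>inverse \<mu>\<close> moves \<open>(0, w0)\<close> onto
      the hyperplane, where the form is \<open>- 2 - c * c * \<Phi>\<close>.\<close>
    define c where "c = 2 * Re w0 / \<Phi>"
    define w where "w = w0 - of_real c * inverse \<mu>"
    have c: "c * \<Phi> = 2 * Re w0" using pos by (simp add: c_def)
    have "(\<Sum>i=1..s - 2. u i * (- c * (u i / a i))) = - c * (\<Sum>i=1..s - 2. (u i)\<^sup>2 / a i)"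
      unfolding sum_distrib_left by (intro sum.cong) (auto simp: power2_eq_square)
    moreover have "2 * Re w = 2 * Re w0 - c * (2 * Re (inverse \<mu>))" by (simp add: w_def)
    ultimately have "(\<Sum>i=1..s - 2. u i * (- c * (u i / a i))) + 2 * Re w = 2 * Re w0 - c * \<Phi>"
      unfolding Re\<mu>[symmetric] by (simp add: algebra_simps)
    then have "0 \<le> qval a m t (\<lambda>i. - c * (u i / a i)) w" using q c by simp
    moreover have "(\<Sum>i=1..s - 2. a i * (- c * (u i / a i))\<^sup>2) = c\<^sup>2 * (\<Sum>i=1..s - 2. (u i)\<^sup>2 / a i)"
      unfolding sum_distrib_left using anz by (intro sum.cong) (auto simp: power2_eq_square)
    moreover have "\<mu> * w\<^sup>2 = - 1 - of_real (2 * c) * w0 + of_real (c\<^sup>2) * inverse \<mu>"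
      using \<mu> by (simp add: w_def w0[symmetric] power2_eq_square field_simps)
    ultimately have "0 \<le> c\<^sup>2 * (\<Sum>i=1..s - 2. (u i)\<^sup>2 / a i) + 2 * (- 1 - 2 * c * Re w0 + c\<^sup>2 * Re (inverse \<mu>))"
      unfolding qval_def \<mu>_def[symmetric] by simp
    also have "\<dots> = c * (c * \<Phi>) - 2 - 4 * c * Re w0"
      unfolding Re\<mu>[symmetric] by (simp add: power2_eq_square algebra_simps)
    also have "\<dots> = - 2 - 4 * (Re w0)\<^sup>2 / \<Phi>" unfolding c by (simp add: c_def power2_eq_square)
    also have "\<dots> < 0"
      using pos by (smt (verit) divide_nonneg_pos zero_le_power2)
    finally show False by simp
  qed
  moreover have "\<not> \<Phi> < 0"
  proof
    assume neg: "\<Phi> < 0"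
    \<comment> \<open>Lowering \<open>a 1\<close> to \<open>b\<close> makes the parameter sum
      exactly 0, so the form stays nonnegative; then \<open>a 1 - b\<close> times the evaluation at
      \<open>v 1\<close> could be split off.\<close>
    define b where "b = (u 1)\<^sup>2 / ((u 1)\<^sup>2 / a 1 - \<Phi>)"
    note 1 = s_facts(3)
    have u1: "0 < (u 1)\<^sup>2" using u_nonzero[OF 1] by simp
    have den: "0 < (u 1)\<^sup>2 / a 1" "(u 1)\<^sup>2 / a 1 < (u 1)\<^sup>2 / a 1 - \<Phi>" using u1 a[OF 1] neg by auto
    have b: "0 < b" using u1 den by (simp add: b_def)
    have "b < (u 1)\<^sup>2 / ((u 1)\<^sup>2 / a 1)"
      unfolding b_def using u1 den neg by (intro divide_strict_left_mono mult_pos_pos) linarith+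
    then have ba: "b < a 1" using u1 by simp
    have ub: "(u 1)\<^sup>2 / b = (u 1)\<^sup>2 / a 1 - \<Phi>" using u1 den by (simp add: b_def)
    have split: "(\<Sum>i=1..s - 2. h i) = h 1 + (\<Sum>i\<in>{1..s - 2} - {1}. h i)" for h :: "nat \<Rightarrow> real"
      using 1 by (intro sum.remove) auto
    have "(\<Sum>i=1..s - 2. (u i)\<^sup>2 / (a(1 := b)) i) = (\<Sum>i=1..s - 2. (u i)\<^sup>2 / a i) - \<Phi>"
      unfolding split[of "\<lambda>i. (u i)\<^sup>2 / (a(1 := b)) i"] split[of "\<lambda>i. (u i)\<^sup>2 / a i"] using ub by simp
    then have le: "2 * m / (m\<^sup>2 + t\<^sup>2) + (\<Sum>i=1..s - 2. (u i)\<^sup>2 / (a(1 := b)) i) \<le> 0" by (simp add: \<Phi>_def)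
    obtain f where f: "f \<in> forms d" "l (f ^ 2) < (a 1 - b) * (ev f (v 1))\<^sup>2"
      using extreme_no_point_part[OF l 1, of "a 1 - b"] ba by auto
    have "0 \<le> qval (a(1 := b)) m t (\<lambda>i. ev f (v i)) (ev f z)"
      using real_relation[OF f(1)] a b le mt by (intro qval_nonneg) auto
    also have "\<dots> = qval a m t (\<lambda>i. ev f (v i)) (ev f z) - (a 1 - b) * (ev f (v 1))\<^sup>2"
      unfolding qval_def split[of "\<lambda>i. (a(1 := b)) i * (ev f (v i))\<^sup>2"] split[of "\<lambda>i. a i * (ev f (v i))\<^sup>2"]
      by (simp add: algebra_simps)
    finally show False using f by (simp add: rep pair_functional_square)
  qed
  ultimately have "\<Phi> = 0" by simp
  then show ?thesis using a mt by (simp add: admissible_def \<Phi>_def)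
qed

end

section \<open>Projective points and the conclusion\<close>

lemma proj_pt_eqD:
  assumes "proj_pt x = proj_pt y" "y \<noteq> 0"
  obtains c where "c \<noteq> 0" "x = c *s y"
proof -
  have "x \<in> vec.span {y}" using assms(1) vec.span_base[of x "{x}"] by (auto simp: proj_pt_def)
  then obtain c where c: "x = c *s y" by (auto simp: vec.span_singleton)
  have "c \<noteq> 0"
  proof
    assume "c = 0"
    then have "vec.span {y} = {0}" using assms(1) c by (simp add: proj_pt_def vec.span_singleton)
    then show False using assms(2) vec.span_base[of y "{y}"] by auto
  qed
  then show ?thesis using that c by blast
qed

lemma proj_pt_scale:
  assumes "c \<noteq> 0"
  shows "proj_pt (c *s y) = proj_pt y"
proof -
  have "k *s y \<in> range (\<lambda>k. k *s (c *s y))" for k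
    using assms by (intro image_eqI[of _ _ "k / c"]) auto
  then show ?thesis unfolding proj_pt_def vec.span_singleton by auto
qed

text \<open>Homogeneity makes vanishing independent of the representative.\<close>

lemma common_zerosD:
  assumes "proj_pt x \<in> common_zeros r F" "\<And>j. j \<in> {1..r} \<Longrightarrow> F j \<in> forms d"
  shows "x \<noteq> 0" "\<And>j. j \<in> {1..r} \<Longrightarrow> ev (F j) x = 0"
proof -
  obtain y where y: "proj_pt x = proj_pt y" "y \<noteq> 0" "\<forall>j\<in>{1..r}. ev (F j) y = 0"
    using assms(1) by (auto simp: common_zeros_def)
  then obtain c where c: "c \<noteq> 0" "x = c *s y" using proj_pt_eqD by blast
  show "x \<noteq> 0" using c y by simp
  show "ev (F j) x = 0" if "j \<in> {1..r}" for j
    using that c y ev_homogeneous[OF assms(2)[OF that], of c y] by simp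
qed

theorem theorem7p1:
  fixes l :: "'n::finite rpoly \<Rightarrow> real"
    and d s :: nat
    and F :: "nat \<Rightarrow> 'n rpoly"
    and \<gamma> :: "nat \<Rightarrow> (complex ^ 'n) set"
    and v :: "nat \<Rightarrow> real ^ 'n"
    and z :: "complex ^ 'n"
    and u :: "nat \<Rightarrow> real"
  assumes "(CARD('n), 2 * d) = (3, 6) \<or> (CARD('n), 2 * d) = (4, 4)"
    and "s = d ^ (CARD('n) - 1)"
    and "spans_extreme_ray d l"
    and "\<not> is_point_evaluation d l"
    and "\<forall>j\<in>{1..CARD('n) - 1}. F j \<in> Qker d l"
    and "intersect_transversely (CARD('n) - 1) F"
    and "bij_betw \<gamma> {1..s} (common_zeros (CARD('n) - 1) F)"
    and "\<forall>i\<in>{1..s - 2}. \<gamma> i = proj_pt (cvec (v i))"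
    and "\<gamma> (s - 1) = proj_pt z" and "\<gamma> s = proj_pt (cnj_vec z)"
    and "\<forall>w :: real ^ 'n. proj_pt z \<noteq> proj_pt (cvec w)"
    and "eval_relation d (s - 2) v z (\<lambda>i. complex_of_real (u i)) 1 1"
    and "\<forall>w b c. eval_relation d (s - 2) v z w b c \<longrightarrow>
           (\<exists>k. (\<forall>i\<in>{1..s - 2}. w i = k * complex_of_real (u i)) \<and> b = k \<and> c = k)"
  shows "(\<exists>!(a, m, t). a \<in> extensional {1..s - 2} \<and> admissible (s - 2) u a m t \<and>
            (\<forall>f\<in>forms d. Qform l f = pair_form (s - 2) v z a m t f))
       \<and> (\<forall>a m t. admissible (s - 2) u a m t \<longrightarrow>
            (\<exists>l'. spans_extreme_ray d l' \<and>
               (\<forall>f\<in>forms d. Qform l' f = pair_form (s - 2) v z a m t f)))"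
proof -
  define r where "r = CARD('n) - 1"
  have params: "CARD('n) = 3 \<and> d = 3 \<and> r = 2 \<and> s = 9 \<or> CARD('n) = 4 \<and> d = 2 \<and> r = 3 \<and> s = 8"
    using assms(1,2) by (auto simp: r_def)
  have F: "F j \<in> Qker d l" "F j \<in> forms d" if "j \<in> {1..r}" for j
    using assms(5) that by (auto simp: r_def Qker_def)
  have \<gamma>: "\<gamma> k \<in> common_zeros r F" if "k \<in> {1..s}" for k
    using assms(7) that by (auto simp: r_def bij_betw_def)
  let ?P = "insert z ((\<lambda>i. cvec (v i)) ` {1..s - 2})"
  have cz: "proj_pt x \<in> common_zeros r F" if "x \<in> ?P" for x
  proof -
    from that consider "x = z" | i where "i \<in> {1..s - 2}" "x = cvec (v i)" by blast
    then show ?thesis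
    proof cases
      case 1
      have "s - 1 \<in> {1..s}" using params by auto
      then show ?thesis using \<gamma> assms(9) 1 by metis
    next
      case 2
      then have "i \<in> {1..s}" by auto
      then show ?thesis using \<gamma> assms(8) 2 by metis
    qed
  qed
  have nonzero: "x \<noteq> 0" and F_zero: "j \<in> {1..r} \<Longrightarrow> ev (F j) x = 0" if "x \<in> ?P" for x j
    using common_zerosD[OF cz[OF that] F(2)] by auto
  interpret cb_configuration d r s F v z u ?P
  proof unfold_locales
    show "?P \<equiv> insert z ((\<lambda>i. cvec (v i)) ` {1..s - 2})" .
    show "grad_independent r F x" if "x \<in> ?P" for x
    proof -
      have "x \<noteq> 0 \<and> (\<forall>j\<in>{1..r}. ev (F j) x = 0)" using nonzero F_zero that by blast
      then show ?thesis
        using assms(6) unfolding r_def[symmetric] intersect_transversely_def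
        by (blast intro: independent_imp_grad_independent)
    qed
    show "v i \<noteq> 0" if "i \<in> {1..s - 2}" for i
    proof
      assume "v i = 0"
      then have "cvec (v i) = 0" by (simp add: cvec_def vec_eq_iff)
      moreover have "cvec (v i) \<in> ?P" using that by blast
      ultimately show False using nonzero by metis
    qed
    show "z \<noteq> k *s cvec y" for k y
    proof
      assume z: "z = k *s cvec y"
      then have "k \<noteq> 0" using nonzero[of z] by auto
      then show False using assms(11) proj_pt_scale z by metis
    qed
    show "\<exists>k. (\<forall>i\<in>{1..s - 2}. w i = k * complex_of_real (u i)) \<and> b = k \<and> c = k"
      if "eval_relation d (s - 2) v z w b c" for w b c
      using assms(13) that by blast
  qed (use params F F_zero assms(12) in auto)
  have l_dual: "l \<in> form_dual (2 * d)" using assms(3) by (simp add: spans_extreme_ray_def sos_dual_def)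
  obtain a m t where rep: "l = pair_functional a m t"
    using pair_functional_representation[OF l_dual F(1)] by blast
  have adm: "admissible (s - 2) u a m t" using extreme_admissible[OF assms(3,4) rep] .
  have Q: "Qform (pair_functional a m t) f = pair_form (s - 2) v z a m t f" if "f \<in> forms d" for a m t f
    using pair_functional_square[OF that] by (simp add: Qform_def pair_form_qval)
  have "\<exists>!(a, m, t). a \<in> extensional {1..s - 2} \<and> admissible (s - 2) u a m t \<and>
            (\<forall>f\<in>forms d. Qform l f = pair_form (s - 2) v z a m t f)"
  \<comment> \<open>Restricting \<open>a\<close> fixes its values off the index range, so that the
    function itself is unique.\<close>
  proof (rule ex1I[of _ "(restrict a {1..s - 2}, m, t)"])
    have "pair_form (s - 2) v z (restrict a {1..s - 2}) m t f = pair_form (s - 2) v z a m t f" for f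
      by (simp add: pair_form_def)
    moreover have "admissible (s - 2) u (restrict a {1..s - 2}) m t"
      using adm by (simp add: admissible_def)
    ultimately show "case (restrict a {1..s - 2}, m, t) of (a, m, t) \<Rightarrow>
        a \<in> extensional {1..s - 2} \<and> admissible (s - 2) u a m t \<and>
        (\<forall>f\<in>forms d. Qform l f = pair_form (s - 2) v z a m t f)"
      using Q by (simp add: rep)
  next
    fix x assume x: "case x of (a, m, t) \<Rightarrow>
        a \<in> extensional {1..s - 2} \<and> admissible (s - 2) u a m t \<and>
        (\<forall>f\<in>forms d. Qform l f = pair_form (s - 2) v z a m t f)"
    obtain a' m' t' where x_eq: "x = (a', m', t')" by (cases x)
    have "pair_form (s - 2) v z a' m' t' f = pair_form (s - 2) v z a m t f" if "f \<in> forms d" for f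
      using x Q[OF that, of a m t] that by (simp add: x_eq rep)
    then have "m' = m \<and> t' = t \<and> (\<forall>i\<in>{1..s - 2}. a' i = a i)" by (rule pair_form_unique)
    moreover from this x have "a' = restrict a {1..s - 2}"
      by (intro extensionalityI[of _ "{1..s - 2}"]) (auto simp: x_eq)
    ultimately show "x = (restrict a {1..s - 2}, m, t)" by (simp add: x_eq)
  qed
  moreover have "\<exists>l'. spans_extreme_ray d l' \<and> (\<forall>f\<in>forms d. Qform l' f = pair_form (s - 2) v z a m t f)"
    if "admissible (s - 2) u a m t" for a m t
    using pair_functional_extreme[OF that] Q by blast
  ultimately show ?thesis by blast
qed

end
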